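(* Let $T$ be a semi-infinite banded stochastic matrix ($p$ subdiagonals, $q$ superdiagonals) admitting a positive bidiagonal factorization, let $N\in\mathbb N_0$, let $\hat T^{[N]}=\frac{1}{\lambda_0^{[N]}}\delta(u_0^{\langle N\rangle})^{-1}T^{[N]}\delta(u_0^{\langle N\rangle})$, and let $x_N:=x/\lambda_0^{[N]}$. For the Markov chain on $\{0,\dots,N\}$ with transition matrix $\hat T^{[N]}$ and for $|s|<1$: 1. the transition probability generating functions are, for $n,m\in\{0,\dots,N\}$, $$P_{m,n}(s)=\frac{u_{0,n}^{\langle N\rangle}}{u_{0,m}^{\langle N\rangle}}\sum_{a=1}^p\sum_{b=1}^{q}\int B^{(b)}_m(x)\,\frac{\mathrm d\psi^{[N]}_{b,a}(x)}{1-sx_N}\,A^{(a)}_{n}(x);$$ 2. for $n,m\in\{0,\dots,N\}$, $m\ne n$, the first passage generating functions are $$F^{[N]}_{m,n}(s)=\frac{u_{0,n}^{\langle N\rangle}}{u_{0,m}^{\langle N\rangle}}\;\frac{\sum_{a=1}^p\sum_{b=1}^{q}\int B^{(b)}_m(x)\frac{\mathrm d\psi^{[N]}_{b,a}(x)}{1-sx_N}A^{(a)}_{n}(x)}{\sum_{a=1}^p\sum_{b=1}^{q}\int B^{(b)}_n(x)\frac{\mathrm d\psi^{[N]}_{b,a}(x)}{1-sx_N}A^{(a)}_{n}(x)};$$ 3. for $m\in\{0,\dots,N\}$ the first return generating function is $$F^{[N]}_{m}(s)=F^{[N]}_{m,m}(s)=1-\frac{1}{\sum_{a=1}^p\sum_{b=1}^{q}\int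 B^{(b)}_m(x)\frac{\mathrm d\psi^{[N]}_{b,a}(x)}{1-sx_N}A^{(a)}_{m}(x)}.$$
   Context: Generating functions: for a Markov chain $(X_r)$ with transition matrix $\hat T^{[N]}$, $P_{i,j}(s)=\sum_{r\ge0}((\hat T^{[N]})^r)_{i,j}s^r$ and $F^{[N]}_{i,j}(s)=\sum_{r\ge1}f^r_{i,j}s^r$ with $f^r_{i,j}=\Pr(X_r=j,X_{r-1}\ne j,\dots,X_1\neq j\mid X_0=i)$. Semi-infinite matrices are indexed by $\mathbb N_0$. $p,q\ge1$ are integers. $T$ is stochastic (nonnegative entries, rows sum to $1$) and banded: $T_{n,m}=0$ unless $n-p\le m\le n+q$, with positive entries inside the band. A positive bidiagonal factorization is $T=\mathscr L_1\cdots\mathscr L_p\mathscr U_q\cdots\mathscr U_1$ with each $\mathscr L_i$ lower bidiagonal with positive main diagonal and first subdiagonal, and each $\mathscr U_j$ upper bidiagonal with positive main diagonal and first superdiagonal (all other entries zero). $\delta(v)$ is the diagonal matrix with diagonal $v$. $T^{[N]}=(T_{n,m})_{n,m=0}^N$; its eigenvalues $\lambda_0^{[N]}>\dots>\lambda_N^{[N]}$ are simple and positive (known). Recursion polynomials. Fix real unitriangular lower matrices $\nu\in\mathbb R^{p\times p}$ and $\xi\in\mathbb R^{q\times q}$ (ones on the diagonal, zeros above). For $a\in\{1,\dots,p\}$, the polynomials $A^{(a)}_n(x)$, $n\ge0$, are determined by $A^{(a)}_n=\nu_{n+1,a}$ for $0\le n\le p-1$ and $\sum_{l\ge0}A^{(a)}_l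 T_{l,n}=xA^{(a)}_n$, $n\ge0$. For $b\in\{1,\dots,q\}$, $B^{(b)}_n(x)$ are determined by $B^{(b)}_n=\xi_{n+1,b}$ for $0\le n\le q-1$ and $\sum_{l\ge0}T_{n,l}B^{(b)}_l=xB^{(b)}_n$, $n\ge0$. Let $P_0=1$, $P_{M}(x)=\det(xI_{M}-T^{[M-1]})$ for $M\ge1$ (characteristic polynomials, not to be confused with the generating functions $P_{m,n}(s)$); $\alpha_0=\beta_0=1$, $\alpha_N=(-1)^{(p-1)N}T_{p,0}\cdots T_{N+p-1,N-1}$, $\beta_N=(-1)^{(q-1)N}T_{0,q}\cdots T_{N-1,N+q-1}$ for $N\ge 1$. For $n\ge0$, $Q_{n,N}$ is the $p\times p$ determinant with rows $(A^{(1)}_l,\dots,A^{(p)}_l)$, $l=n,N+1,\dots,N+p-1$ (in this order), and $R_{n,N}$ is the $q\times q$ determinant with rows $(B^{(1)}_l,\dots,B^{(q)}_l)$, $l=n,N+1,\dots,N+q-1$. Eigenvectors: $u^{\langle N\rangle}_{k,n}=\beta_N R_{n,N}(\lambda_k^{[N]})$ and $w^{\langle N\rangle}_{k,n}=\dfrac{\alpha_N Q_{n,N}(\lambda_k^{[N]})}{P_N(\lambda_k^{[N]})P_{N+1}'(\lambda_k^{[N]})}$ for $n\ge 0$ (so $u_{k,n}^{\langle N\rangle}=0$ for $N<n\le N+q-1$ and $w_{k,n}^{\langle N\rangle}=0$ for $N<n\le N+p-1$). Known facts: $u^{\langle N\rangle}_k=(u_{k,n}^{\langle N\rangle})_{n=0}^N$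 (column) and $w^{\langle N\rangle}_k=(w_{k,n}^{\langle N\rangle})_{n=0}^N$ (row) are right and left eigenvectors of $T^{[N]}$ for $\lambda_k^{[N]}$, with $w_k^{\langle N\rangle}u_l^{\langle N\rangle}=\delta_{k,l}$, and $u^{\langle N\rangle}_0,w^{\langle N\rangle}_0$ have all entries positive. Christoffel numbers: $(\mu_{k,1}^{[N]},\dots,\mu_{k,p}^{[N]})^\top=\nu^{-1}(w_{k,0}^{\langle N\rangle},\dots,w_{k,p-1}^{\langle N\rangle})^\top$, $(\rho_{k,1}^{[N]},\dots,\rho_{k,q}^{[N]})^\top=\xi^{-1}(u_{k,0}^{\langle N\rangle},\dots,u_{k,q-1}^{\langle N\rangle})^\top$; one has $w_{k,n}^{\langle N\rangle}=\sum_a A_n^{(a)}(\lambda_k^{[N]})\mu_{k,a}^{[N]}$, $u_{k,n}^{\langle N\rangle}=\sum_b B_n^{(b)}(\lambda_k^{[N]})\rho_{k,b}^{[N]}$. The discrete measures are $\mathrm d\psi^{[N]}_{b,a}=\sum_{k=0}^N\rho^{[N]}_{k,b}\mu^{[N]}_{k,a}\,\delta_{\lambda_k^{[N]}}$ (point masses at the eigenvalues). *)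

theory Defs
  imports "HOL-Probability.Probability" "Jordan_Normal_Form.Char_Poly"
begin

section \<open>Semi-infinite matrices\<close>

text \<open>A semi-infinite matrix is a function of two indices in \<open>nat\<close>. In all products below the rows
  have finite support, so the series have only finitely many nonzero terms.\<close>

definition smat_mult :: "(nat \<Rightarrow> nat \<Rightarrow> real) \<Rightarrow> (nat \<Rightarrow> nat \<Rightarrow> real) \<Rightarrow> nat \<Rightarrow> nat \<Rightarrow> real" where
  "smat_mult A B = (\<lambda>n m. \<Sum>l. A n l * B l m)"

definition smat_one :: "nat \<Rightarrow> nat \<Rightarrow> real" where
  "smat_one = (\<lambda>n m. if n = m then 1 else 0)"

definition smat_prod_list :: "(nat \<Rightarrow> nat \<Rightarrow> real) list \<Rightarrow> nat \<Rightarrow> nat \<Rightarrow> real" where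
  "smat_prod_list As = foldr smat_mult As smat_one"

definition stochastic_smat :: "(nat \<Rightarrow> nat \<Rightarrow> real) \<Rightarrow> bool" where
  "stochastic_smat T \<longleftrightarrow> (\<forall>n m. 0 \<le> T n m) \<and> (\<forall>n. (\<lambda>m. T n m) sums 1)"

definition positive_banded :: "nat \<Rightarrow> nat \<Rightarrow> (nat \<Rightarrow> nat \<Rightarrow> real) \<Rightarrow> bool" where
  "positive_banded p q T \<longleftrightarrow>
     (\<forall>n m. if n \<le> m + p \<and> m \<le> n + q then 0 < T n m else T n m = 0)"

definition positive_lower_bidiagonal :: "(nat \<Rightarrow> nat \<Rightarrow> real) \<Rightarrow> bool" where
  "positive_lower_bidiagonal L \<longleftrightarrow>
     (\<forall>n m. if n = m \<or> n = Suc m then 0 < L n m else L n m = 0)"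

definition positive_upper_bidiagonal :: "(nat \<Rightarrow> nat \<Rightarrow> real) \<Rightarrow> bool" where
  "positive_upper_bidiagonal U \<longleftrightarrow>
     (\<forall>n m. if m = n \<or> m = Suc n then 0 < U n m else U n m = 0)"

definition has_positive_bidiagonal_factorization ::
    "nat \<Rightarrow> nat \<Rightarrow> (nat \<Rightarrow> nat \<Rightarrow> real) \<Rightarrow> bool" where
  "has_positive_bidiagonal_factorization p q T \<longleftrightarrow>
     (\<exists>L U. (\<forall>i\<in>{1..p}. positive_lower_bidiagonal (L i)) \<and>
            (\<forall>j\<in>{1..q}. positive_upper_bidiagonal (U j)) \<and>
            T = smat_prod_list (map L [1..<Suc p] @ map U (rev [1..<Suc q])))"


section \<open>Truncations, their eigenvalues and characteristic polynomials\<close>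

text \<open>The truncation \<open>T\<^sup>[\<^sup>N\<^sup>]\<close>, of size \<open>N + 1\<close>.\<close>

definition trunc :: "(nat \<Rightarrow> nat \<Rightarrow> real) \<Rightarrow> nat \<Rightarrow> real mat" where
  "trunc T N = Matrix.mat (Suc N) (Suc N) (\<lambda>(n, m). T n m)"

text \<open>The eigenvalues of \<open>T\<^sup>[\<^sup>N\<^sup>]\<close> in decreasing order. For the matrices considered here there are
  exactly \<open>N + 1\<close> of them, so \<open>eigval T N k\<close> is meaningful for \<open>k \<le> N\<close>.\<close>

definition eigval :: "(nat \<Rightarrow> nat \<Rightarrow> real) \<Rightarrow> nat \<Rightarrow> nat \<Rightarrow> real" where
  "eigval T N k = rev (sorted_list_of_set {x. eigenvalue (trunc T N) x}) ! k"

definition charP :: "(nat \<Rightarrow> nat \<Rightarrow> real) \<Rightarrow> nat \<Rightarrow> real poly" where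
  "charP T M = (if M = 0 then 1 else char_poly (trunc T (M - 1)))"


section \<open>Recursion polynomials\<close>

definition lower_unitriangular :: "nat \<Rightarrow> real mat \<Rightarrow> bool" where
  "lower_unitriangular d A \<longleftrightarrow> A \<in> carrier_mat d d \<and>
     (\<forall>i<d. A $$ (i, i) = 1) \<and> (\<forall>i<d. \<forall>j<d. i < j \<longrightarrow> A $$ (i, j) = 0)"

text \<open>The superscripts \<open>a \<in> {1,\<dots>,p}\<close> and \<open>b \<in> {1,\<dots>,q}\<close>, and the indices of \<open>\<nu>\<close> and \<open>\<xi>\<close>, are shifted
  to start at 0: \<open>A a n\<close> stands for the polynomial with superscript \<open>a + 1\<close> and subscript \<open>n\<close>.\<close>

definition left_recursion_polys ::
    "nat \<Rightarrow> (nat \<Rightarrow> nat \<Rightarrow> real) \<Rightarrow> real mat \<Rightarrow> (nat \<Rightarrow> nat \<Rightarrow> real poly) \<Rightarrow> bool" where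
  "left_recursion_polys p T \<nu> A \<longleftrightarrow>
     (\<forall>a<p. (\<forall>n<p. A a n = [:\<nu> $$ (n, a):]) \<and>
            (\<forall>n x. (\<Sum>l. poly (A a l) x * T l n) = x * poly (A a n) x))"

definition right_recursion_polys ::
    "nat \<Rightarrow> (nat \<Rightarrow> nat \<Rightarrow> real) \<Rightarrow> real mat \<Rightarrow> (nat \<Rightarrow> nat \<Rightarrow> real poly) \<Rightarrow> bool" where
  "right_recursion_polys q T \<xi> B \<longleftrightarrow>
     (\<forall>b<q. (\<forall>n<q. B b n = [:\<xi> $$ (n, b):]) \<and>
            (\<forall>n x. (\<Sum>l. T n l * poly (B b l) x) = x * poly (B b n) x))"

text \<open>The \<open>d \<times> d\<close> determinant with rows \<open>(C 0 l, \<dots>, C (d - 1) l)\<close> for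
  \<open>l = n, N + 1, \<dots>, N + d - 1\<close>. With \<open>C = A\<close>, \<open>d = p\<close> this is \<open>Q\<^sub>n\<^sub>,\<^sub>N\<close>; with \<open>C = B\<close>, \<open>d = q\<close> it is
  \<open>R\<^sub>n\<^sub>,\<^sub>N\<close>.\<close>

definition rec_det :: "nat \<Rightarrow> (nat \<Rightarrow> nat \<Rightarrow> real poly) \<Rightarrow> nat \<Rightarrow> nat \<Rightarrow> real poly" where
  "rec_det d C n N =
     Determinant.det (Matrix.mat d d (\<lambda>(i, c). C c (if i = 0 then n else N + i)))"

definition alpha :: "nat \<Rightarrow> (nat \<Rightarrow> nat \<Rightarrow> real) \<Rightarrow> nat \<Rightarrow> real" where
  "alpha p T N = (- 1) ^ ((p - 1) * N) * (\<Prod>i<N. T (p + i) i)"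

definition beta :: "nat \<Rightarrow> (nat \<Rightarrow> nat \<Rightarrow> real) \<Rightarrow> nat \<Rightarrow> real" where
  "beta q T N = (- 1) ^ ((q - 1) * N) * (\<Prod>i<N. T i (q + i))"


section \<open>Eigenvectors, Christoffel numbers and discrete measures\<close>

definition uvec ::
    "nat \<Rightarrow> (nat \<Rightarrow> nat \<Rightarrow> real) \<Rightarrow> (nat \<Rightarrow> nat \<Rightarrow> real poly) \<Rightarrow> nat \<Rightarrow> nat \<Rightarrow> nat \<Rightarrow> real" where
  "uvec q T B N k n = beta q T N * poly (rec_det q B n N) (eigval T N k)"

definition wvec ::
    "nat \<Rightarrow> (nat \<Rightarrow> nat \<Rightarrow> real) \<Rightarrow> (nat \<Rightarrow> nat \<Rightarrow> real poly) \<Rightarrow> nat \<Rightarrow> nat \<Rightarrow> nat \<Rightarrow> real" where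
  "wvec p T A N k n =
     alpha p T N * poly (rec_det p A n N) (eigval T N k) /
     (poly (charP T N) (eigval T N k) * poly (pderiv (charP T (Suc N))) (eigval T N k))"

definition christoffel_mu :: "nat \<Rightarrow> (nat \<Rightarrow> nat \<Rightarrow> real) \<Rightarrow> real mat \<Rightarrow>
    (nat \<Rightarrow> nat \<Rightarrow> real poly) \<Rightarrow> nat \<Rightarrow> nat \<Rightarrow> real Matrix.vec" where
  "christoffel_mu p T \<nu> A N k = the (mat_inverse \<nu>) *\<^sub>v Matrix.vec p (wvec p T A N k)"

definition christoffel_rho :: "nat \<Rightarrow> (nat \<Rightarrow> nat \<Rightarrow> real) \<Rightarrow> real mat \<Rightarrow>
    (nat \<Rightarrow> nat \<Rightarrow> real poly) \<Rightarrow> nat \<Rightarrow> nat \<Rightarrow> real Matrix.vec" where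
  "christoffel_rho q T \<xi> B N k = the (mat_inverse \<xi>) *\<^sub>v Matrix.vec q (uvec q T B N k)"

text \<open>The integral against the discrete measure \<open>\<Sum>k\<in>K. c k \<delta>\<^sub>t\<^sub>(\<^sub>k\<^sub>)\<close>. The weights may have any sign, so
  the measure is signed and its integral is the corresponding linear combination of the integrals
  against the Dirac measures \<open>return borel (t k)\<close>.\<close>

definition dirac_comb_integral ::
    "'k set \<Rightarrow> ('k \<Rightarrow> real) \<Rightarrow> ('k \<Rightarrow> real) \<Rightarrow> (real \<Rightarrow> complex) \<Rightarrow> complex" where
  "dirac_comb_integral K c t f =
     (\<Sum>k\<in>K. complex_of_real (c k) * (\<integral>x. f x \<partial>return borel (t k)))"

definition psi_integral :: "nat \<Rightarrow> nat \<Rightarrow> (nat \<Rightarrow> nat \<Rightarrow> real) \<Rightarrow> real mat \<Rightarrow> real mat \<Rightarrow>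
    (nat \<Rightarrow> nat \<Rightarrow> real poly) \<Rightarrow> (nat \<Rightarrow> nat \<Rightarrow> real poly) \<Rightarrow> nat \<Rightarrow> nat \<Rightarrow> nat \<Rightarrow>
    (real \<Rightarrow> complex) \<Rightarrow> complex" where
  "psi_integral p q T \<nu> \<xi> A B N b a f =
     dirac_comb_integral {..N}
       (\<lambda>k. vec_index (christoffel_rho q T \<xi> B N k) b * vec_index (christoffel_mu p T \<nu> A N k) a)
       (eigval T N) f"

text \<open>The spectral sum
  \<open>\<Sum>\<^sub>a \<Sum>\<^sub>b \<integral> B\<^sup>(\<^sup>b\<^sup>)\<^sub>m(x) d\<psi>\<^sub>b\<^sub>,\<^sub>a(x) / (1 - s x\<^sub>N) A\<^sup>(\<^sup>a\<^sup>)\<^sub>n(x)\<close> with \<open>x\<^sub>N = x / \<lambda>\<^sub>0\<close>.\<close>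

definition spectral_sum :: "nat \<Rightarrow> nat \<Rightarrow> (nat \<Rightarrow> nat \<Rightarrow> real) \<Rightarrow> real mat \<Rightarrow> real mat \<Rightarrow>
    (nat \<Rightarrow> nat \<Rightarrow> real poly) \<Rightarrow> (nat \<Rightarrow> nat \<Rightarrow> real poly) \<Rightarrow> nat \<Rightarrow> nat \<Rightarrow> nat \<Rightarrow>
    complex \<Rightarrow> complex" where
  "spectral_sum p q T \<nu> \<xi> A B N m n s =
     (\<Sum>a<p. \<Sum>b<q. psi_integral p q T \<nu> \<xi> A B N b a
        (\<lambda>x. complex_of_real (poly (B b m) x) *
             (1 / (1 - s * complex_of_real (x / eigval T N 0))) *
             complex_of_real (poly (A a n) x)))"


section \<open>Markov chains and generating functions\<close>

definition That ::
    "nat \<Rightarrow> (nat \<Rightarrow> nat \<Rightarrow> real) \<Rightarrow> (nat \<Rightarrow> nat \<Rightarrow> real poly) \<Rightarrow> nat \<Rightarrow> real mat" where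
  "That q T B N =
     (1 / eigval T N 0) \<cdot>\<^sub>m
       (the (mat_inverse (mat_diag (Suc N) (uvec q T B N 0))) * trunc T N *
        mat_diag (Suc N) (uvec q T B N 0))"

text \<open>\<open>X\<close> is a time-homogeneous Markov chain on \<open>{0,\<dots>,N}\<close> with transition matrix \<open>S\<close>; the initial
  distribution is arbitrary.\<close>

definition markov_chain :: "'w measure \<Rightarrow> (nat \<Rightarrow> 'w \<Rightarrow> nat) \<Rightarrow> nat \<Rightarrow> real mat \<Rightarrow> bool" where
  "markov_chain M X N S \<longleftrightarrow>
     prob_space M \<and>
     (\<forall>r. X r \<in> measurable M (count_space {..N})) \<and>
     (\<forall>r i j. j \<le> N \<longrightarrow> \<P>(\<omega> in M. \<forall>l\<le>r. X l \<omega> = i l) > 0 \<longrightarrow>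
        \<P>(\<omega> in M. X (Suc r) \<omega> = j \<bar> \<forall>l\<le>r. X l \<omega> = i l) = S $$ (i r, j))"

definition first_passage_prob ::
    "'w measure \<Rightarrow> (nat \<Rightarrow> 'w \<Rightarrow> nat) \<Rightarrow> nat \<Rightarrow> nat \<Rightarrow> nat \<Rightarrow> real" where
  "first_passage_prob M X i j r =
     \<P>(\<omega> in M. X r \<omega> = j \<and> (\<forall>l. 1 \<le> l \<and> l < r \<longrightarrow> X l \<omega> \<noteq> j) \<bar> X 0 \<omega> = i)"

definition transition_gf :: "real mat \<Rightarrow> nat \<Rightarrow> nat \<Rightarrow> complex \<Rightarrow> complex" where
  "transition_gf S i j s = (\<Sum>r. complex_of_real ((S ^\<^sub>m r) $$ (i, j)) * s ^ r)"

text \<open>The sum runs over \<open>r \<ge> 1\<close>, hence the shift.\<close>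

definition first_passage_gf ::
    "'w measure \<Rightarrow> (nat \<Rightarrow> 'w \<Rightarrow> nat) \<Rightarrow> nat \<Rightarrow> nat \<Rightarrow> complex \<Rightarrow> complex" where
  "first_passage_gf M X i j s =
     (\<Sum>r. complex_of_real (first_passage_prob M X i j (Suc r)) * s ^ Suc r)"

end

theory Submission
  imports Defs
begin

text \<open>Multiplication by a positive bidiagonal matrix does not increase the number of sign changes of a
  vector. If a vector that ends in a positive entry is an eigenvector of a truncation of \<open>T\<close> for a
  positive eigenvalue, the next entry of its image under \<open>T\<close> is therefore positive. The same holds
  for left eigenvectors, and a Schur complement turns this into the Sturm property: at a positive root
  of \<open>P\<^sub>k\<^sub>+\<^sub>1\<close> that is not a root of \<open>P\<^sub>k\<close>, the values of \<open>P\<^sub>k\<close> and \<open>P\<^sub>k\<^sub>+\<^sub>2\<close> have opposite signs. Hence the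
  roots of consecutive characteristic polynomials interlace, and \<open>T\<^sup>[\<^sup>N\<^sup>]\<close> has \<open>N + 1\<close> distinct positive
  eigenvalues.

  The determinants \<open>Q\<^sub>n\<^sub>,\<^sub>N\<close> and \<open>R\<^sub>n\<^sub>,\<^sub>N\<close> give eigenvectors whose last entries are known multiples of \<open>P\<^sub>N\<close>,
  and the derivative of \<open>P\<^sub>N\<^sub>+\<^sub>1\<close>, read off the adjugate matrix, shows that they are biorthonormal. The
  resulting spectral decomposition sums the transition generating function. First passages are
  governed by the renewal equation \<open>P\<^sub>m\<^sub>n = \<delta>\<^sub>m\<^sub>n + F\<^sub>m\<^sub>n P\<^sub>n\<^sub>n\<close>.\<close>

section \<open>Sign changes under positive bidiagonal matrices\<close>

text \<open>An eigenvector of a truncation is padded with zeros and sent through the semi-infinite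
  factors: the upper ones keep its support in \<open>{..k}\<close>, the lower ones leak past
  \<open>k\<close>, and the leaked entry at \<open>k + 1\<close> is what is measured. The eigenvalue
  equation makes the number of sign changes return to its initial value, so no factor can lose one
  on the way; this rigidity fixes the sign of the leaked entry. The condition that
  \<open>P_N\<close> does not vanish at the eigenvalues of \<open>T^[N]\<close> recurs everywhere:
  it makes each kernel a line whose vectors are fixed by their last entry. The interlacing induction
  carries it as strict alternation of signs. Only ratios of entries of \<open>u_0\<close> enter
  \<open>That\<close>, so a common sign of these entries is what matters; it comes from the
  dominance of the eigenvalue with index 0. The powers of \<open>That\<close> are bounded by their
  spectral formula, which gives the absolute convergence behind the Cauchy product. First passage
  weights are defined from the matrix alone and matched with the chain afterwards, so the renewal
  equation at \<open>n\<close> also holds, and yields a nonzero diagonal generating function, if the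
  chain never starts in \<open>n\<close>.\<close>

text \<open>Both functions look at the entries \<open>x 0, \<dots>, x n\<close> and skip zeros; \<open>last_sign\<close> is 0 if there is no
  nonzero entry.\<close>

primrec last_sign :: "(nat \<Rightarrow> real) \<Rightarrow> nat \<Rightarrow> real" where
  "last_sign x 0 = sgn (x 0)"
| "last_sign x (Suc n) = (if x (Suc n) = 0 then last_sign x n else sgn (x (Suc n)))"

primrec sign_changes :: "(nat \<Rightarrow> real) \<Rightarrow> nat \<Rightarrow> nat" where
  "sign_changes x 0 = 0"
| "sign_changes x (Suc n) =
     sign_changes x n + (if last_sign x n * x (Suc n) < 0 then 1 else 0)"

lemma last_sign_nonzero: "x n \<noteq> 0 \<Longrightarrow> last_sign x n = sgn (x n)"
  by (cases n) auto

lemma last_sign_cases: "last_sign x n = -1 \<or> last_sign x n = 0 \<or> last_sign x n = 1"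
  by (induction n) (auto simp: sgn_real_def)

lemma last_sign_zero: "last_sign x n = 0 \<Longrightarrow> x n = 0 \<and> sign_changes x n = 0"
  by (induction n) (auto simp: sgn_real_def split: if_splits)

lemma sign_changes_scale:
  assumes "c > 0" and "\<And>i. i \<le> n \<Longrightarrow> y i = c * x i"
  shows "sign_changes y n = sign_changes x n \<and> last_sign y n = last_sign x n"
  using assms(2)
proof (induction n)
  case 0
  then show ?case using assms(1) by (auto simp: sgn_mult)
next
  case (Suc n)
  have "last_sign x n * (c * x (Suc n)) < 0 \<longleftrightarrow> last_sign x n * x (Suc n) < 0"
    using assms(1) by (simp add: mult.left_commute[of _ c] mult_less_0_iff)
  then show ?case using Suc assms(1) by (auto simp: sgn_mult)
qed

definition lower_step :: "(nat \<Rightarrow> nat \<Rightarrow> real) \<Rightarrow> (nat \<Rightarrow> real) \<Rightarrow> nat \<Rightarrow> real" where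
  "lower_step L x n = L n n * x n + (if n = 0 then 0 else L n (n - 1) * x (n - 1))"

definition upper_step :: "(nat \<Rightarrow> nat \<Rightarrow> real) \<Rightarrow> (nat \<Rightarrow> real) \<Rightarrow> nat \<Rightarrow> real" where
  "upper_step U x n = U n n * x n + U n (Suc n) * x (Suc n)"

text \<open>The product of the last sign and \<open>(-1)\<close> to the number of changes is the
  sign of the first nonzero entry, so it stays constant once such an entry has occurred.\<close>

lemma parity_step:
  assumes "last_sign x n \<noteq> 0"
  shows "last_sign x (Suc n) * (-1) ^ sign_changes x (Suc n) =
         last_sign x n * (-1) ^ sign_changes x n"
  using assms last_sign_cases[of x n] by (auto simp: sgn_real_def)

text \<open>The second conjunct says that the first nonzero entries of both vectors have the same
  sign, and it drives the induction. If both counts agree so far, the last signs agree too, and a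
  new change in the image forces one in \<open>x\<close>, the new entry being a positive combination
  of \<open>x (Suc n)\<close> and \<open>x n\<close>. If the image has strictly fewer changes, the
  gap absorbs a new one.\<close>

lemma lower_step_sign_changes:
  assumes L: "positive_lower_bidiagonal L"
  shows "sign_changes (lower_step L x) n \<le> sign_changes x n \<and>
    last_sign (lower_step L x) n * (-1) ^ sign_changes (lower_step L x) n =
    last_sign x n * (-1) ^ sign_changes x n"
proof (induction n)
  case 0
  have "L 0 0 > 0" using L by (auto simp: positive_lower_bidiagonal_def)
  then show ?case by (simp add: lower_step_def sgn_mult)
next
  case (Suc n)
  let ?y = "lower_step L x"
  have a: "L (Suc n) (Suc n) > 0" and b: "L (Suc n) n > 0"
    using L by (auto simp: positive_lower_bidiagonal_def)
  have y: "?y (Suc n) = L (Suc n) (Suc n) * x (Suc n) + L (Suc n) n * x n"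
    by (simp add: lower_step_def)
  show ?case
  proof (cases "last_sign x n = 0")
    case True
    then have "last_sign ?y n = 0" using Suc by simp
    with True have "x n = 0" "sign_changes x n = 0" "sign_changes ?y n = 0"
      using last_sign_zero by blast+
    then show ?thesis using True \<open>last_sign ?y n = 0\<close> a y by (simp add: sgn_mult)
  next
    case False
    then have F': "last_sign ?y n \<noteq> 0" using Suc by auto
    have par: "last_sign ?y (Suc n) * (-1) ^ sign_changes ?y (Suc n) =
      last_sign x (Suc n) * (-1) ^ sign_changes x (Suc n)"
      using parity_step[OF False] parity_step[OF F'] Suc by simp
    have "sign_changes ?y (Suc n) \<le> sign_changes x (Suc n)"
    proof (cases "sign_changes ?y n = sign_changes x n")
      case True
      then have s: "last_sign ?y n = last_sign x n" using Suc by simp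
      have xn: "last_sign x n * x n \<ge> 0"
        using last_sign_nonzero[of x n] by (cases "x n = 0") (auto simp: sgn_real_def)
      have "last_sign x n * x (Suc n) < 0" if neg: "last_sign x n * ?y (Suc n) < 0"
      proof (rule ccontr)
        assume "\<not> ?thesis"
        then have "0 \<le> L (Suc n) (Suc n) * (last_sign x n * x (Suc n))"
          using a by (simp only: not_less) (rule mult_nonneg_nonneg[OF less_imp_le])
        moreover have "0 \<le> L (Suc n) n * (last_sign x n * x n)"
          using b xn by (rule mult_nonneg_nonneg[OF less_imp_le])
        ultimately show False using neg by (simp add: y algebra_simps)
      qed
      then show ?thesis using True s by auto
    next
      case False
      then show ?thesis using Suc by auto
    qed
    with par show ?thesis by blast
  qed
qed

text \<open>Equal counts give equal last signs, so only a zero entry must be excluded. A zero would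
  force \<open>x k < 0\<close>, hence a change of \<open>x\<close> at the last position that the
  image lacks, and the image would then have fewer changes.\<close>

lemma lower_step_last_pos:
  assumes L: "positive_lower_bidiagonal L"
    and eq: "sign_changes (lower_step L x) (Suc k) = sign_changes x (Suc k)"
    and pos: "x (Suc k) > 0"
  shows "lower_step L x (Suc k) > 0"
proof -
  let ?y = "lower_step L x"
  have a: "L (Suc k) (Suc k) > 0" and b: "L (Suc k) k > 0"
    using L by (auto simp: positive_lower_bidiagonal_def)
  have y: "?y (Suc k) = L (Suc k) (Suc k) * x (Suc k) + L (Suc k) k * x k"
    by (simp add: lower_step_def)
  have ls: "last_sign ?y (Suc k) = 1"
    using lower_step_sign_changes[OF L, of x "Suc k"] eq pos
    by (simp del: sign_changes.simps)
  have "?y (Suc k) \<noteq> 0"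
  proof
    assume z: "?y (Suc k) = 0"
    then have "L (Suc k) k * x k < 0"
      using y mult_pos_pos[OF a pos] by linarith
    then have "x k < 0" using b by (simp add: mult_less_0_iff)
    then have "last_sign x k = -1" using last_sign_nonzero[of x k] by simp
    then have "sign_changes x (Suc k) = Suc (sign_changes x k)" using pos by simp
    moreover have "sign_changes ?y (Suc k) = sign_changes ?y k" using z by simp
    moreover have "sign_changes ?y k \<le> sign_changes x k"
      using lower_step_sign_changes[OF L] by blast
    ultimately show False using eq by linarith
  qed
  then show ?thesis using ls by (simp add: sgn_real_def split: if_splits)
qed

text \<open>Here \<open>e\<close> is the last sign before the adjacent entries \<open>v\<close> and \<open>w\<close>, and \<open>v'\<close> is a positive
  combination of these two.\<close>

lemma sign_changes_insert:
  fixes e v w v' t :: real and s S :: nat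
  assumes e: "e = -1 \<or> e = 0 \<or> e = 1"
    and pos: "v > 0 \<and> w \<ge> 0 \<or> v \<ge> 0 \<and> w > 0 \<Longrightarrow> v' > 0"
    and neg: "v < 0 \<and> w \<le> 0 \<or> v \<le> 0 \<and> w < 0 \<Longrightarrow> v' < 0"
    and zero: "v = 0 \<Longrightarrow> w = 0 \<Longrightarrow> v' = 0"
    and S: "s + (if e * v < 0 then 1 else 0) \<le> S"
    and t: "(if v = 0 then e else sgn v) = t"
  shows "s + (if e * v' < 0 then 1 else 0) +
      (if (if v' = 0 then e else sgn v') * w < 0 then 1 else 0) \<le>
      S + (if t * w < 0 then 1 else 0) \<and>
    (if w = 0 then if v' = 0 then e else sgn v' else sgn w) = (if w = 0 then t else sgn w)"
proof -
  have "v < 0 \<or> v = 0 \<or> v > 0" "w < 0 \<or> w = 0 \<or> w > 0" "v' < 0 \<or> v' = 0 \<or> v' > 0" by linarith+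
  with e show ?thesis
    using pos neg zero S unfolding t[symmetric]
    by (elim disjE) (simp_all add: mult_less_0_iff)
qed

text \<open>The left side counts the sign changes of the mixed sequence
  \<open>y 0, ..., y k, x (k + 1)\<close>. The entries of \<open>x\<close> are exchanged for those
  of the image from left to right: each new one is a positive combination of its predecessor and its
  successor in \<open>x\<close>, so no step of the exchange adds a change.\<close>

lemma upper_step_sign_changes_aux:
  assumes U: "positive_upper_bidiagonal U"
  shows "sign_changes (upper_step U x) k +
      (if last_sign (upper_step U x) k * x (Suc k) < 0 then 1 else 0) \<le> sign_changes x (Suc k) \<and>
    (if x (Suc k) = 0 then last_sign (upper_step U x) k else sgn (x (Suc k))) =
      last_sign x (Suc k)"
proof (induction k)
  case 0
  have a: "U 0 0 > 0" and b: "U 0 (Suc 0) > 0" using U by (auto simp: positive_upper_bidiagonal_def)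
  have y: "upper_step U x 0 = U 0 0 * x 0 + U 0 (Suc 0) * x (Suc 0)" by (simp add: upper_step_def)
  have 1: "x 0 \<ge> 0 \<Longrightarrow> x (Suc 0) \<ge> 0 \<Longrightarrow> upper_step U x 0 \<ge> 0"
    using a b y by simp
  have 2: "x 0 \<le> 0 \<Longrightarrow> x (Suc 0) \<le> 0 \<Longrightarrow> upper_step U x 0 \<le> 0"
    using a b y mult_nonneg_nonpos[of "U 0 0" "x 0"] mult_nonneg_nonpos[of "U 0 (Suc 0)" "x (Suc 0)"] 
    by simp
  have 3: "x (Suc 0) = 0 \<Longrightarrow> sgn (upper_step U x 0) = sgn (x 0)"
    using a y by (simp add: sgn_mult)
  show ?case using 1 2 3 by (auto simp: sgn_real_def mult_less_0_iff)
next
  case (Suc k)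
  let ?y = "upper_step U x"
  let ?v = "x (Suc k)" and ?w = "x (Suc (Suc k))"
  have a: "U (Suc k) (Suc k) > 0" and b: "U (Suc k) (Suc (Suc k)) > 0"
    using U by (auto simp: positive_upper_bidiagonal_def)
  have y: "?y (Suc k) = U (Suc k) (Suc k) * ?v + U (Suc k) (Suc (Suc k)) * ?w"
    by (simp add: upper_step_def)
  have 1: "?v > 0 \<and> ?w \<ge> 0 \<or> ?v \<ge> 0 \<and> ?w > 0 \<Longrightarrow> ?y (Suc k) > 0"
    using a b y by (auto intro: add_pos_nonneg add_nonneg_pos)
  have "?v < 0 \<and> ?w \<le> 0 \<or> ?v \<le> 0 \<and> ?w < 0 \<Longrightarrow> - ?y (Suc k) > 0"
    using a b y add_pos_nonneg[of "U (Suc k) (Suc k) * (-?v)" "U (Suc k) (Suc (Suc k)) * (-?w)"]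
      add_nonneg_pos[of "U (Suc k) (Suc k) * (-?v)" "U (Suc k) (Suc (Suc k)) * (-?w)"]
    by (auto simp: mult_less_0_iff mult_le_0_iff)
  then have 2: "?v < 0 \<and> ?w \<le> 0 \<or> ?v \<le> 0 \<and> ?w < 0 \<Longrightarrow> ?y (Suc k) < 0" by simp
  have 3: "?v = 0 \<Longrightarrow> ?w = 0 \<Longrightarrow> ?y (Suc k) = 0" using y by simp
  show ?case
    using sign_changes_insert[of "last_sign ?y k" ?v ?w "?y (Suc k)" "sign_changes ?y k"
      "sign_changes x (Suc k)" "last_sign x (Suc k)"] last_sign_cases[of ?y k] 1 2 3 Suc
    by (simp only: last_sign.simps(2)[of _ "Suc k"] sign_changes.simps(2)[of _ "Suc k"]
        last_sign.simps(2)[of ?y k] sign_changes.simps(2)[of ?y k])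
qed

lemma upper_step_sign_changes:
  assumes U: "positive_upper_bidiagonal U" and z: "x (Suc k) = 0"
  shows "sign_changes (upper_step U x) k \<le> sign_changes x k"
  using upper_step_sign_changes_aux[OF U, of x k] z by simp

lemma foldr_lower_step_sign_changes:
  assumes "\<forall>L\<in>set Ls. positive_lower_bidiagonal L"
  shows "sign_changes (foldr lower_step Ls x) n \<le> sign_changes x n"
  using assms
proof (induction Ls)
  case (Cons L Ls)
  then show ?case
    using lower_step_sign_changes[of L "foldr lower_step Ls x" n] by fastforce
qed simp

text \<open>The innermost factor moves the positive entry at \<open>k\<close> to
  \<open>k + 1\<close> through its subdiagonal. Counts cannot increase from factor to factor, so
  overall equality is equality at each factor, and \<open>lower_step_last_pos\<close> carries
  positivity through the remaining ones.\<close>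

lemma foldr_lower_step_last_pos:
  assumes "\<forall>L\<in>set Ls. positive_lower_bidiagonal L" and "Ls \<noteq> []"
    and "sign_changes (foldr lower_step Ls x) (Suc k) = sign_changes x (Suc k)"
    and "x (Suc k) = 0" and "x k > 0"
  shows "foldr lower_step Ls x (Suc k) > 0"
  using assms(1-3)
proof (induction Ls)
  case (Cons L Ls)
  let ?y = "foldr lower_step Ls x"
  have L: "positive_lower_bidiagonal L" using Cons by simp
  show ?case
  proof (cases "Ls = []")
    case True
    have "L (Suc k) k > 0" using L by (auto simp: positive_lower_bidiagonal_def)
    then show ?thesis using True assms(4,5) by (simp add: lower_step_def)
  next
    case False
    have "sign_changes (lower_step L ?y) (Suc k) \<le> sign_changes ?y (Suc k)"
      using lower_step_sign_changes[OF L] by blast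
    moreover have "sign_changes ?y (Suc k) \<le> sign_changes x (Suc k)"
      by (rule foldr_lower_step_sign_changes) (use Cons in auto)
    moreover have "sign_changes (lower_step L ?y) (Suc k) = sign_changes x (Suc k)"
      using Cons.prems by (simp del: sign_changes.simps)
    ultimately have e1: "sign_changes ?y (Suc k) = sign_changes x (Suc k)"
      and e2: "sign_changes (lower_step L ?y) (Suc k) = sign_changes ?y (Suc k)" by linarith+
    have "?y (Suc k) > 0" using Cons.IH[OF _ False e1] Cons.prems by simp
    then show ?thesis using lower_step_last_pos[OF L e2] by simp
  qed
qed simp

lemma foldr_upper_step:
  assumes "\<forall>U\<in>set Us. positive_upper_bidiagonal U" and "\<forall>i>k. x i = 0" and "x k > 0"
  shows "sign_changes (foldr upper_step Us x) k \<le> sign_changes x k \<and>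
    (\<forall>i>k. foldr upper_step Us x i = 0) \<and> foldr upper_step Us x k > 0"
  using assms(1)
proof (induction Us)
  case Nil
  then show ?case using assms by simp
next
  case (Cons U Us)
  let ?y = "foldr upper_step Us x"
  have U: "positive_upper_bidiagonal U" using Cons by simp
  have IH: "sign_changes ?y k \<le> sign_changes x k" "\<forall>i>k. ?y i = 0" "?y k > 0"
    using Cons by auto
  have "sign_changes (upper_step U ?y) k \<le> sign_changes ?y k"
    by (rule upper_step_sign_changes[OF U]) (use IH in auto)
  moreover have "U k k > 0" using U by (auto simp: positive_upper_bidiagonal_def)
  then have "upper_step U ?y k > 0" and "\<forall>i>k. upper_step U ?y i = 0"
    using IH by (auto simp: upper_step_def)
  ultimately show ?case using IH by simp
qed

text \<open>If the entry \<open>k + 1\<close> of the image were not positive, passing to the image would either lose a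
  sign change among the entries up to \<open>k + 1\<close> or create one.\<close>

lemma bidiagonal_steps_extension_pos:
  assumes Ls: "\<forall>L\<in>set Ls. positive_lower_bidiagonal L" "Ls \<noteq> []"
    and Us: "\<forall>U\<in>set Us. positive_upper_bidiagonal U"
    and x: "\<forall>i>k. x i = 0" "x k > 0"
    and eig: "\<And>i. i \<le> k \<Longrightarrow> foldr lower_step Ls (foldr upper_step Us x) i = c * x i"
    and c: "c > 0"
  shows "foldr lower_step Ls (foldr upper_step Us x) (Suc k) > 0"
proof -
  let ?y = "foldr upper_step Us x" and ?z = "foldr lower_step Ls (foldr upper_step Us x)"
  have y: "sign_changes ?y k \<le> sign_changes x k" "?y (Suc k) = 0" "?y k > 0"
    using foldr_upper_step[OF Us x] by auto
  \<comment> \<open>Up to index \<open>k\<close> the image is a positive multiple of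
    \<open>x\<close>. This closes the inequalities below into a cycle, so all counts in it
    coincide.\<close>
  have "sign_changes x k = sign_changes ?z k"
    using sign_changes_scale[of c k ?z x, OF c eig] by simp
  moreover have "sign_changes ?z k \<le> sign_changes ?z (Suc k)" by simp
  moreover have "sign_changes ?z (Suc k) \<le> sign_changes ?y (Suc k)"
    by (rule foldr_lower_step_sign_changes[OF Ls(1)])
  moreover have "sign_changes ?y (Suc k) = sign_changes ?y k" using y(2) by simp
  ultimately have "sign_changes ?z (Suc k) = sign_changes ?y (Suc k)" using y(1) by linarith
  then show ?thesis by (rule foldr_lower_step_last_pos[OF Ls]) (use y in auto)
qed

section \<open>Products of semi-infinite bidiagonal matrices\<close>

definition smat_vec :: "(nat \<Rightarrow> nat \<Rightarrow> real) \<Rightarrow> (nat \<Rightarrow> real) \<Rightarrow> nat \<Rightarrow> real" where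
  "smat_vec A x = (\<lambda>n. \<Sum>l. A n l * x l)"

text \<open>A uniform bound on how far rows reach to the right turns the series in
  \<open>smat_vec\<close> and \<open>smat_mult\<close> into finite sums; associativity rests on
  this.\<close>

definition upper_bandwidth :: "(nat \<Rightarrow> nat \<Rightarrow> real) \<Rightarrow> nat \<Rightarrow> bool" where
  "upper_bandwidth A w \<longleftrightarrow> (\<forall>n m. n + w < m \<longrightarrow> A n m = 0)"

lemma smat_mult_smat_vec: "smat_mult A B n m = smat_vec A (\<lambda>l. B l m) n"
  by (simp add: smat_mult_def smat_vec_def)

lemma smat_vec_eq_sum:
  assumes "upper_bandwidth A w" and "n + w \<le> K"
  shows "smat_vec A x n = (\<Sum>l\<le>K. A n l * x l)"
  unfolding smat_vec_def
  by (rule suminf_finite) (use assms in \<open>auto simp: upper_bandwidth_def\<close>)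

lemma upper_bandwidth_mult:
  assumes A: "upper_bandwidth A w" and B: "upper_bandwidth B v"
  shows "upper_bandwidth (smat_mult A B) (w + v)"
  unfolding upper_bandwidth_def smat_mult_smat_vec smat_vec_eq_sum[OF A order_refl]
  using B by (auto simp: upper_bandwidth_def intro!: sum.neutral)

lemma smat_vec_mult:
  assumes A: "upper_bandwidth A w" and B: "upper_bandwidth B v"
  shows "smat_vec (smat_mult A B) x = smat_vec A (smat_vec B x)"
proof
  fix n
  let ?K = "n + w" and ?M = "n + w + v"
  have "smat_vec (smat_mult A B) x n = (\<Sum>l\<le>?M. (\<Sum>k\<le>?K. A n k * B k l) * x l)"
    by (subst smat_vec_eq_sum[OF upper_bandwidth_mult[OF A B], of _ ?M])
       (simp_all add: smat_mult_smat_vec smat_vec_eq_sum[OF A order_refl])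
  also have "\<dots> = (\<Sum>k\<le>?K. A n k * (\<Sum>l\<le>?M. B k l * x l))"
    unfolding sum_distrib_right sum_distrib_left
    by (subst sum.swap) (simp add: mult.assoc)
  also have "\<dots> = (\<Sum>k\<le>?K. A n k * smat_vec B x k)"
    by (intro sum.cong refl) (simp add: smat_vec_eq_sum[OF B, of _ ?M])
  also have "\<dots> = smat_vec A (smat_vec B x) n"
    by (simp add: smat_vec_eq_sum[OF A order_refl])
  finally show "smat_vec (smat_mult A B) x n = smat_vec A (smat_vec B x) n" .
qed

lemma smat_mult_assoc:
  assumes "upper_bandwidth A w" and "upper_bandwidth B v"
  shows "smat_mult (smat_mult A B) C = smat_mult A (smat_mult B C)"
  by (intro ext) (simp add: smat_mult_smat_vec smat_vec_mult[OF assms])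

lemma smat_vec_one: "smat_vec smat_one x = x"
proof
  fix n
  have "smat_vec smat_one x n = (\<Sum>l\<le>n. smat_one n l * x l)"
    by (rule smat_vec_eq_sum[of _ 0]) (auto simp: upper_bandwidth_def smat_one_def)
  also have "\<dots> = (\<Sum>l\<in>{n}. smat_one n l * x l)"
    by (rule sum.mono_neutral_right) (auto simp: smat_one_def)
  finally show "smat_vec smat_one x n = x n" by (simp add: smat_one_def)
qed

lemma smat_one_mult: "smat_mult smat_one A = A"
  by (intro ext) (simp add: smat_mult_smat_vec smat_vec_one)

abbreviation (input) smat_transpose :: "(nat \<Rightarrow> nat \<Rightarrow> real) \<Rightarrow> nat \<Rightarrow> nat \<Rightarrow> real" where
  "smat_transpose A \<equiv> (\<lambda>n m. A m n)"

lemma smat_transpose_mult: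
  "smat_transpose (smat_mult A B) = smat_mult (smat_transpose B) (smat_transpose A)"
  unfolding smat_mult_def by (intro ext suminf_cong) (rule mult.commute)

lemma smat_mult_one: "smat_mult A smat_one = A"
proof (intro ext)
  fix n m
  have "smat_mult A smat_one n m = (\<Sum>l\<in>{m}. A n l * smat_one l m)"
    unfolding smat_mult_def by (rule suminf_finite) (auto simp: smat_one_def)
  then show "smat_mult A smat_one n m = A n m" by (simp add: smat_one_def)
qed

lemma upper_bandwidth_one: "upper_bandwidth smat_one w"
  by (auto simp: upper_bandwidth_def smat_one_def)

lemma upper_bandwidth_prod_list:
  assumes "\<forall>A\<in>set As. upper_bandwidth A w"
  shows "upper_bandwidth (smat_prod_list As) (length As * w)"
  using assms
proof (induction As)
  case (Cons A As)
  then show ?case using upper_bandwidth_mult[of A w] by (simp add: smat_prod_list_def)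
qed (simp add: smat_prod_list_def upper_bandwidth_one)

lemma smat_prod_list_append:
  assumes "\<forall>A\<in>set As. upper_bandwidth A w"
  shows "smat_prod_list (As @ Bs) = smat_mult (smat_prod_list As) (smat_prod_list Bs)"
  using assms
proof (induction As)
  case (Cons A As)
  then show ?case
    using smat_mult_assoc[OF _ upper_bandwidth_prod_list[of As w], of A w]
    by (simp add: smat_prod_list_def)
qed (simp add: smat_prod_list_def smat_one_mult)

lemma smat_vec_prod_list:
  assumes "\<forall>A\<in>set As. upper_bandwidth A w"
  shows "smat_vec (smat_prod_list As) x = foldr smat_vec As x"
  using assms
proof (induction As)
  case (Cons A As)
  then show ?case
    using smat_vec_mult[OF _ upper_bandwidth_prod_list[of As w], of A w]
    by (simp add: smat_prod_list_def)
qed (simp add: smat_prod_list_def smat_vec_one)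

lemma smat_transpose_prod_list:
  assumes "\<forall>A\<in>set As. upper_bandwidth (smat_transpose A) w"
  shows "smat_transpose (smat_prod_list As) = smat_prod_list (rev (map smat_transpose As))"
  using assms
proof (induction As)
  case Nil
  show ?case by (intro ext) (simp add: smat_prod_list_def smat_one_def)
next
  case (Cons A As)
  have "smat_transpose (smat_prod_list (A # As)) =
      smat_mult (smat_transpose (smat_prod_list As)) (smat_transpose A)"
    by (simp add: smat_prod_list_def smat_transpose_mult)
  also have "\<dots> = smat_prod_list (rev (map smat_transpose As) @ [smat_transpose A])"
    by (subst smat_prod_list_append[of _ w])
       (use Cons in \<open>auto simp: smat_prod_list_def smat_mult_one\<close>)
  finally show ?case by simp
qed

text \<open>Lower factors appear with both bounds: 0 expresses triangularity, while
  \<open>Suc 0\<close> is the common bound required for lists that mix lower and upper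
  factors.\<close>

lemma upper_bandwidth_bidiagonal:
  "positive_lower_bidiagonal A \<Longrightarrow> upper_bandwidth A 0"
  "positive_lower_bidiagonal A \<Longrightarrow> upper_bandwidth A (Suc 0)"
  "positive_upper_bidiagonal A \<Longrightarrow> upper_bandwidth A (Suc 0)"
  by (auto simp: upper_bandwidth_def positive_lower_bidiagonal_def positive_upper_bidiagonal_def)

lemma smat_vec_lower:
  assumes L: "positive_lower_bidiagonal L"
  shows "smat_vec L x = lower_step L x"
proof
  fix n
  have "smat_vec L x n = (\<Sum>l\<le>n. L n l * x l)"
    by (rule smat_vec_eq_sum[OF upper_bandwidth_bidiagonal(1)[OF L]]) simp
  also have "\<dots> = (\<Sum>l\<in>{n, n - 1}. L n l * x l)"
    using L by (intro sum.mono_neutral_right) (auto simp: positive_lower_bidiagonal_def)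
  also have "\<dots> = lower_step L x n" by (cases n) (auto simp: lower_step_def)
  finally show "smat_vec L x n = lower_step L x n" .
qed

lemma smat_vec_upper:
  assumes U: "positive_upper_bidiagonal U"
  shows "smat_vec U x = upper_step U x"
proof
  fix n
  have "smat_vec U x n = (\<Sum>l\<le>Suc n. U n l * x l)"
    by (rule smat_vec_eq_sum[OF upper_bandwidth_bidiagonal(3)[OF U]]) simp
  also have "\<dots> = (\<Sum>l\<in>{n, Suc n}. U n l * x l)"
    using U by (intro sum.mono_neutral_right) (auto simp: positive_upper_bidiagonal_def)
  finally show "smat_vec U x n = upper_step U x n" by (simp add: upper_step_def)
qed

text \<open>The numbers of factors are forgotten, which makes the class closed under transposition.
  At least one factor of each kind is kept, since it is a subdiagonal that feeds position
  \<open>k + 1\<close>, for the matrix as well as for its transpose.\<close>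

definition bidiagonal_product :: "(nat \<Rightarrow> nat \<Rightarrow> real) \<Rightarrow> bool" where
  "bidiagonal_product T \<longleftrightarrow> (\<exists>Ls Us. Ls \<noteq> [] \<and> Us \<noteq> [] \<and>
     (\<forall>L\<in>set Ls. positive_lower_bidiagonal L) \<and> (\<forall>U\<in>set Us. positive_upper_bidiagonal U) \<and>
     T = smat_prod_list (Ls @ Us))"

lemma bidiagonal_product_of_factorization:
  assumes "has_positive_bidiagonal_factorization p q T" and "1 \<le> p" and "1 \<le> q"
  shows "bidiagonal_product T"
proof -
  obtain L U where "\<forall>i\<in>{1..p}. positive_lower_bidiagonal (L i)"
      and "\<forall>j\<in>{1..q}. positive_upper_bidiagonal (U j)"
      and "T = smat_prod_list (map L [1..<Suc p] @ map U (rev [1..<Suc q]))"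
    using assms(1) by (auto simp: has_positive_bidiagonal_factorization_def)
  then show ?thesis
    unfolding bidiagonal_product_def using assms(2,3)
    by (intro exI[of _ "map L [1..<Suc p]"] exI[of _ "map U (rev [1..<Suc q])"]) auto
qed

text \<open>Transposition reverses the product and exchanges lower and upper factors, so statements
  on left eigenvectors reduce to those on right eigenvectors.\<close>

lemma bidiagonal_product_transpose:
  assumes "bidiagonal_product T"
  shows "bidiagonal_product (smat_transpose T)"
proof -
  obtain Ls Us where ne: "Ls \<noteq> []" "Us \<noteq> []"
    and Ls: "\<forall>L\<in>set Ls. positive_lower_bidiagonal L"
    and Us: "\<forall>U\<in>set Us. positive_upper_bidiagonal U"
    and T: "T = smat_prod_list (Ls @ Us)"
    using assms by (auto simp: bidiagonal_product_def)
  have l: "positive_upper_bidiagonal (smat_transpose L)" if "L \<in> set Ls" for L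
    using Ls that by (auto simp: positive_lower_bidiagonal_def positive_upper_bidiagonal_def)
  have u: "positive_lower_bidiagonal (smat_transpose U)" if "U \<in> set Us" for U
    using Us that by (auto simp: positive_lower_bidiagonal_def positive_upper_bidiagonal_def)
  have "smat_transpose T =
      smat_prod_list (rev (map smat_transpose Us) @ rev (map smat_transpose Ls))"
    unfolding T using l u
    by (subst smat_transpose_prod_list[of _ 1]) (auto intro: upper_bandwidth_bidiagonal)
  then show ?thesis
    unfolding bidiagonal_product_def using ne l u
    by (intro exI[of _ "rev (map smat_transpose Us)"] exI[of _ "rev (map smat_transpose Ls)"]) auto
qed

lemma foldr_smat_vec_lower:
  "\<forall>L\<in>set Ls. positive_lower_bidiagonal L \<Longrightarrow> foldr smat_vec Ls x = foldr lower_step Ls x"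
  by (induction Ls) (auto simp: smat_vec_lower)

lemma foldr_smat_vec_upper:
  "\<forall>U\<in>set Us. positive_upper_bidiagonal U \<Longrightarrow> foldr smat_vec Us x = foldr upper_step Us x"
  by (induction Us) (auto simp: smat_vec_upper)

lemma bidiagonal_product_extension_pos:
  assumes T: "bidiagonal_product T"
    and pos: "x k > 0" and c: "c > 0"
    and eig: "\<And>i. i \<le> k \<Longrightarrow> (\<Sum>l\<le>k. T i l * x l) = c * x i"
  shows "(\<Sum>l\<le>k. T (Suc k) l * x l) > 0"
proof -
  obtain Ls Us where ne: "Ls \<noteq> []"
    and Ls: "\<forall>L\<in>set Ls. positive_lower_bidiagonal L"
    and Us: "\<forall>U\<in>set Us. positive_upper_bidiagonal U"
    and T: "T = smat_prod_list (Ls @ Us)"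
    using T by (auto simp: bidiagonal_product_def)
  define y where "y = (\<lambda>i. if i \<le> k then x i else 0)"
  have "smat_vec T y = foldr lower_step Ls (foldr upper_step Us y)"
    unfolding T using Ls Us
    by (subst smat_vec_prod_list[of _ 1])
       (auto simp: foldr_smat_vec_lower foldr_smat_vec_upper intro: upper_bandwidth_bidiagonal)
  moreover have "smat_vec T y i = (\<Sum>l\<le>k. T i l * x l)" for i
    unfolding smat_vec_def y_def by (subst suminf_finite[of "{..k}"]) auto
  ultimately have z: "foldr lower_step Ls (foldr upper_step Us y) i = (\<Sum>l\<le>k. T i l * x l)" for i
    by metis
  show ?thesis
    using bidiagonal_steps_extension_pos[OF Ls ne Us, of k y c] eig pos c
    unfolding z by (simp add: y_def)
qed

section \<open>Positivity of the leading principal minors\<close>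

lemma prod_list_lower_triangular:
  assumes "\<forall>L\<in>set Ls. positive_lower_bidiagonal L"
  shows "upper_bandwidth (smat_prod_list Ls) 0 \<and> (\<forall>n. smat_prod_list Ls n n > 0)"
proof
  show bw: "upper_bandwidth (smat_prod_list Ls) 0"
    using upper_bandwidth_prod_list[of Ls 0] assms upper_bandwidth_bidiagonal(1) by simp
  show "\<forall>n. smat_prod_list Ls n n > 0"
    using assms
  proof (induction Ls)
    case (Cons L Ls)
    have L: "positive_lower_bidiagonal L" using Cons by simp
    have "smat_prod_list (L # Ls) n n = L n n * smat_prod_list Ls n n" for n
    proof -
      have "smat_prod_list Ls (n - 1) n = 0" if "n \<noteq> 0"
        using upper_bandwidth_prod_list[of Ls 0] Cons.prems upper_bandwidth_bidiagonal(1) that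
        by (simp add: upper_bandwidth_def)
      moreover have "smat_prod_list (L # Ls) n n = lower_step L (\<lambda>l. smat_prod_list Ls l n) n"
        using smat_vec_lower[OF L] smat_mult_smat_vec[of L "smat_prod_list Ls" n n]
        by (simp add: smat_prod_list_def)
      ultimately show ?thesis by (simp add: lower_step_def)
    qed
    moreover have "L n n > 0" for n using L by (auto simp: positive_lower_bidiagonal_def)
    ultimately show ?case using Cons by simp
  qed (simp add: smat_prod_list_def smat_one_def)
qed

lemma prod_list_upper_triangular:
  assumes "\<forall>U\<in>set Us. positive_upper_bidiagonal U"
  shows "(\<forall>n m. m < n \<longrightarrow> smat_prod_list Us n m = 0) \<and> (\<forall>n. smat_prod_list Us n n > 0)"
  using assms
proof (induction Us)
  case (Cons U Us)
  have U: "positive_upper_bidiagonal U" using Cons by simp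
  have "smat_prod_list (U # Us) n m = upper_step U (\<lambda>l. smat_prod_list Us l m) n" for n m
    using smat_vec_upper[OF U] smat_mult_smat_vec[of U "smat_prod_list Us" n m]
    by (simp add: smat_prod_list_def)
  moreover have "U n n > 0" for n using U by (auto simp: positive_upper_bidiagonal_def)
  ultimately show ?case using Cons by (simp add: upper_step_def)
qed (simp add: smat_prod_list_def smat_one_def)

lemma trunc_carrier [simp]: "trunc T N \<in> carrier_mat (Suc N) (Suc N)"
  by (simp add: trunc_def)

lemma trunc_index [simp]: "i \<le> N \<Longrightarrow> j \<le> N \<Longrightarrow> trunc T N $$ (i, j) = T i j"
  by (simp add: trunc_def)

text \<open>With a lower triangular left factor, rows up to \<open>N\<close> use only summands up to
  \<open>N\<close>. So the truncation of the product is the product of the truncations, which are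
  triangular with positive diagonals.\<close>

lemma det_trunc_pos:
  assumes "bidiagonal_product T"
  shows "Determinant.det (trunc T N) > 0"
proof -
  obtain Ls Us where Ls: "\<forall>L\<in>set Ls. positive_lower_bidiagonal L"
    and Us: "\<forall>U\<in>set Us. positive_upper_bidiagonal U"
    and T: "T = smat_prod_list (Ls @ Us)"
    using assms by (auto simp: bidiagonal_product_def)
  let ?L = "smat_prod_list Ls" and ?U = "smat_prod_list Us"
  have L: "upper_bandwidth ?L 0" "\<And>n. ?L n n > 0" using prod_list_lower_triangular[OF Ls] by auto
  have U: "\<And>n m. m < n \<Longrightarrow> ?U n m = 0" "\<And>n. ?U n n > 0"
    using prod_list_upper_triangular[OF Us] by auto
  have "T = smat_mult ?L ?U"
    unfolding T using Ls by (subst smat_prod_list_append[of _ 0])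
      (auto intro: upper_bandwidth_bidiagonal)
  then have T': "T n m = (\<Sum>l\<le>N. ?L n l * ?U l m)" if "n \<le> N" for n m
    using that smat_vec_eq_sum[OF L(1), of n N] by (simp add: smat_mult_smat_vec)
  have "trunc T N = trunc ?L N * trunc ?U N"
    by (rule eq_matI)
       (auto simp: T' trunc_def scalar_prod_def less_Suc_eq_le atLeast0LessThan lessThan_Suc_atMost
          intro!: sum.cong)
  then have "Determinant.det (trunc T N) =
      Determinant.det (trunc ?L N) * Determinant.det (trunc ?U N)"
    by (simp add: det_mult[of _ "Suc N"])
  moreover have "Determinant.det (trunc ?L N) = prod_list (diag_mat (trunc ?L N))"
    by (rule det_lower_triangular[of "Suc N"]) (use L in \<open>auto simp: upper_bandwidth_def\<close>)
  moreover have "Determinant.det (trunc ?U N) = prod_list (diag_mat (trunc ?U N))"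
    by (rule det_upper_triangular[of _ "Suc N"]) (use U in \<open>auto simp: trunc_def\<close>)
  moreover have "prod_list (diag_mat (trunc A N)) > 0" if "\<And>n. A n n > 0" for A
    unfolding prod_list_diag_prod using that by (intro prod_pos) (auto simp: trunc_def)
  ultimately show ?thesis using L(2) U(2) by simp
qed

section \<open>Interlacing of the characteristic polynomials\<close>

text \<open>Indexed by the size, so that size 0 is available and \<open>charP T 0 = 1\<close>
  becomes the empty determinant instead of a special case.\<close>

definition leading :: "(nat \<Rightarrow> nat \<Rightarrow> 'a) \<Rightarrow> nat \<Rightarrow> 'a mat" where
  "leading C n = Matrix.mat n n (\<lambda>(i, j). C i j)"

lemma leading_carrier [simp]: "leading C n \<in> carrier_mat n n"
  by (simp add: leading_def)

lemma leading_dim [simp]: "dim_row (leading C n) = n" "dim_col (leading C n) = n"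
  by (simp_all add: leading_def)

lemma leading_index [simp]: "i < n \<Longrightarrow> j < n \<Longrightarrow> leading C n $$ (i, j) = C i j"
  by (simp add: leading_def)

lemma trunc_eq_leading: "trunc T N = leading T (Suc N)"
  by (simp add: trunc_def leading_def)

lemma det_leading_transpose:
  "Determinant.det (leading (\<lambda>i j. C j i) n) = Determinant.det (leading C n)"
proof -
  have "leading (\<lambda>i j. C j i) n = transpose_mat (leading C n)"
    by (rule eq_matI) auto
  then show ?thesis by (simp add: Determinant.det_transpose[of _ n])
qed

text \<open>The entries of \<open>xI - T\<close> at a fixed number \<open>x\<close>, kept
  semi-infinite so that its leading minors are the values of all characteristic polynomials at
  \<open>x\<close>.\<close>

definition shifted :: "(nat \<Rightarrow> nat \<Rightarrow> real) \<Rightarrow> real \<Rightarrow> nat \<Rightarrow> nat \<Rightarrow> real" where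
  "shifted T x i j = (if i = j then x else 0) - T i j"

lemma charP_eq: "charP T M = char_poly (leading T M)"
proof (cases M)
  case 0
  then show ?thesis by (simp add: charP_def char_poly_def det_def leading_def char_poly_matrix_def)
next
  case (Suc m)
  then show ?thesis by (simp add: charP_def trunc_eq_leading)
qed

lemma poly_charP: "poly (charP T M) x = Determinant.det (leading (shifted T x) M)"
  unfolding charP_eq char_poly_def
  by (rule poly_det_cong[of _ M])
     (auto simp: shifted_def char_poly_matrix_def)

lemma sum_shifted:
  assumes "i \<le> N"
  shows "(\<Sum>l\<le>N. shifted T x i l * u l) = x * u i - (\<Sum>l\<le>N. T i l * u l)"
proof -
  have "(\<Sum>l\<le>N. shifted T x i l * u l) = (\<Sum>l\<le>N. (if i = l then x * u l else 0) - T i l * u l)"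
    by (intro sum.cong) (auto simp: shifted_def algebra_simps)
  then show ?thesis using assms by (simp add: sum_subtractf)
qed

lemma sum_shifted_offdiag:
  assumes "N < i"
  shows "(\<Sum>l\<le>N. shifted T x i l * u l) = - (\<Sum>l\<le>N. T i l * u l)"
  unfolding sum_negf[symmetric]
  by (intro sum.cong) (use assms in \<open>auto simp: shifted_def\<close>)

lemma shifted_transpose: "shifted (\<lambda>i j. T j i) x i j = shifted T x j i"
  by (simp add: shifted_def)

lemma charP_transpose: "charP (\<lambda>i j. T j i) M = charP T M"
proof -
  have "leading (\<lambda>i j. T j i) M = transpose_mat (leading T M)"
    by (rule eq_matI) auto
  then show ?thesis by (simp add: charP_eq char_poly_transpose_mat[of _ M])
qed

section \<open>Kernel vectors over a nonsingular leading block\<close>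

lemma leading_mult_vec_index:
  assumes "i < n" and "v \<in> carrier_vec n"
  shows "vec_index (leading C n *\<^sub>v v) i = (\<Sum>l<n. C i l * vec_index v l)"
  using assms by (simp add: scalar_prod_def atLeast0LessThan)

lemma kernel_trivial:
  fixes C :: "nat \<Rightarrow> nat \<Rightarrow> real"
  assumes det: "Determinant.det (leading C n) \<noteq> 0"
    and ker: "\<And>i. i < n \<Longrightarrow> (\<Sum>l<n. C i l * v l) = 0" and i: "i < n"
  shows "v i = 0"
proof (rule ccontr)
  assume "v i \<noteq> 0"
  then have "Matrix.vec n v \<noteq> 0\<^sub>v n" using i by (metis index_vec index_zero_vec(1))
  moreover have "leading C n *\<^sub>v Matrix.vec n v = 0\<^sub>v n"
    by (rule eq_vecI) (use ker in \<open>auto simp: scalar_prod_def atLeast0LessThan\<close>)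
  ultimately show False
    using det det_0_iff_vec_prod_zero_field[of "leading C n" n]
    by (metis leading_carrier vec_carrier)
qed

text \<open>A kernel vector with last entry 0 would restrict to a kernel vector of the nonsingular
  leading block, so the last entry can be scaled to 1.\<close>

lemma kernel_exists:
  fixes C :: "nat \<Rightarrow> nat \<Rightarrow> real"
  assumes det: "Determinant.det (leading C (Suc k)) = 0" and sub: "Determinant.det (leading C k) \<noteq> 0"
  obtains u where "u k = 1" and "\<And>i. i \<le> k \<Longrightarrow> (\<Sum>l\<le>k. C i l * u l) = 0"
proof -
  obtain v where v: "v \<in> carrier_vec (Suc k)" "v \<noteq> 0\<^sub>v (Suc k)"
      "leading C (Suc k) *\<^sub>v v = 0\<^sub>v (Suc k)"
    using det det_0_iff_vec_prod_zero_field[of "leading C (Suc k)" "Suc k"] by auto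
  define u where "u l = vec_index v l" for l
  have u: "(\<Sum>l\<le>k. C i l * u l) = 0" if "i \<le> k" for i
    using leading_mult_vec_index[of i "Suc k" v C] v that
    by (simp add: u_def lessThan_Suc_atMost)
  have "u k \<noteq> 0"
  proof
    assume z: "u k = 0"
    have "(\<Sum>l<k. C i l * u l) = 0" if "i < k" for i
      using u[of i] that z by (simp add: lessThan_Suc_atMost[symmetric])
    then have "u i = 0" if "i < k" for i using kernel_trivial[OF sub] that by blast
    then have "v = 0\<^sub>v (Suc k)"
      by (intro eq_vecI) (use v z in \<open>auto simp: u_def less_Suc_eq\<close>)
    then show False using v by simp
  qed
  moreover have "(\<Sum>l\<le>k. C i l * (u l / u k)) = 0" if "i \<le> k" for i
    using u[OF that] by (simp add: sum_divide_distrib[symmetric])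
  ultimately show thesis by (intro that[of "\<lambda>l. u l / u k"]) auto
qed

text \<open>The combination \<open>u k * v - v k * u\<close> has last entry 0 and is annihilated by
  the nonsingular leading block. Only the first \<open>k\<close> rows enter, which is what allows
  vectors whose last row equation is still unknown.\<close>

lemma kernel_unique:
  fixes C :: "nat \<Rightarrow> nat \<Rightarrow> real"
  assumes sub: "Determinant.det (leading C k) \<noteq> 0"
    and u: "\<And>i. i < k \<Longrightarrow> (\<Sum>l\<le>k. C i l * u l) = 0"
    and v: "\<And>i. i < k \<Longrightarrow> (\<Sum>l\<le>k. C i l * v l) = 0"
    and i: "i \<le> k"
  shows "u k * v i = v k * u i"
proof -
  let ?d = "\<lambda>l. u k * v l - v k * u l"
  have "(\<Sum>l<k. C i l * ?d l) = 0" if "i < k" for i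
  proof -
    have "(\<Sum>l\<le>k. C i l * ?d l) = u k * (\<Sum>l\<le>k. C i l * v l) - v k * (\<Sum>l\<le>k. C i l * u l)"
      by (simp add: sum_distrib_left sum_subtractf algebra_simps)
    then have "(\<Sum>l\<le>k. C i l * ?d l) = 0" using u v that by simp
    then show ?thesis by (simp add: lessThan_Suc_atMost[symmetric])
  qed
  then have "?d i = 0" if "i < k" using kernel_trivial[OF sub, of ?d i] that by blast
  then show ?thesis using i by (cases "i = k") auto
qed

text \<open>Replacing row \<open>k\<close> of the matrix by the combination \<open>w\<close> of its rows and column \<open>k\<close> by the
  combination \<open>u\<close> of its columns leaves one nonzero entry in each.\<close>

lemma det_bordered:
  fixes C :: "nat \<Rightarrow> nat \<Rightarrow> real"
  assumes u: "\<And>i. i \<le> k \<Longrightarrow> (\<Sum>l\<le>k. C i l * u l) = 0"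
    and w: "\<And>j. j \<le> k \<Longrightarrow> (\<Sum>l\<le>k. C l j * w l) = 0"
  shows "w k * Determinant.det (leading C (Suc (Suc k))) * u k =
    - ((\<Sum>l\<le>k. C l (Suc k) * w l) * (\<Sum>l\<le>k. C (Suc k) l * u l) * Determinant.det (leading C k))"
proof -
  let ?n = "Suc (Suc k)"
  define t where "t = (\<Sum>l\<le>k. C l (Suc k) * w l)"
  define r where "r = (\<Sum>l\<le>k. C (Suc k) l * u l)"
  define E where "E = leading (\<lambda>i j. if i = k then if j \<le> k then w j else 0 else if i = j then 1 else 0) ?n"
  define F where "F = leading (\<lambda>i j. if j = k then if i \<le> k then u i else 0 else if i = j then 1 else 0) ?n"
  define X where "X = leading (\<lambda>i j. if i = k then if j = Suc k then t else 0
    else if j = k then if i = Suc k then r else 0 else C i j) ?n"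
  have cE: "E \<in> carrier_mat ?n ?n" and cF: "F \<in> carrier_mat ?n ?n"
    by (simp_all add: E_def F_def)
  have dE: "Determinant.det E = w k"
    by (subst det_lower_triangular[of ?n])
       (auto simp: E_def prod_list_diag_prod)
  have dF: "Determinant.det F = u k"
    by (subst det_upper_triangular[of _ ?n])
       (auto simp: F_def prod_list_diag_prod)
  define G where "G = leading (\<lambda>i j. if i = k then if j = Suc k then t else 0 else C i j) ?n"
  have G: "E * leading C ?n = G"
  proof (rule eq_matI)
    fix i j
    assume "i < dim_row G" "j < dim_col G"
    then have ij: "i < ?n" "j < ?n" by (simp_all add: G_def)
    then have "(E * leading C ?n) $$ (i, j) = (\<Sum>l<?n. E $$ (i, l) * C l j)"
      by (simp add: scalar_prod_def E_def atLeast0LessThan)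
    also have "\<dots> = G $$ (i, j)"
    proof (cases "i = k")
      case True
      have "(\<Sum>l<?n. E $$ (i, l) * C l j) = (\<Sum>l\<le>k. C l j * w l)"
        using True by (simp add: E_def lessThan_Suc_atMost[symmetric] mult.commute)
      also have "\<dots> = G $$ (i, j)"
        using True ij w[of j] by (auto simp: G_def t_def less_Suc_eq)
      finally show ?thesis .
    next
      case False
      have "(\<Sum>l<?n. E $$ (i, l) * C l j) = (\<Sum>l<?n. if i = l then C l j else 0)"
        by (intro sum.cong refl) (use False ij in \<open>auto simp: E_def\<close>)
      also have "\<dots> = G $$ (i, j)" using False ij by (simp add: G_def del: sum.lessThan_Suc)
      finally show ?thesis .
    qed
    finally show "(E * leading C ?n) $$ (i, j) = G $$ (i, j)" .
  qed (simp_all add: E_def G_def)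
  have "G * F = X"
  proof (rule eq_matI)
    fix i j
    assume "i < dim_row X" "j < dim_col X"
    then have ij: "i < ?n" "j < ?n" by (simp_all add: X_def)
    then have "(G * F) $$ (i, j) = (\<Sum>l<?n. G $$ (i, l) * F $$ (l, j))"
      by (simp add: scalar_prod_def G_def F_def atLeast0LessThan)
    also have "\<dots> = X $$ (i, j)"
    proof (cases "j = k")
      case True
      have "(\<Sum>l<?n. G $$ (i, l) * F $$ (l, j)) = (\<Sum>l\<le>k. G $$ (i, l) * u l)"
        using True by (simp add: F_def lessThan_Suc_atMost[symmetric])
      also have "\<dots> = (if i = k then 0 else (\<Sum>l\<le>k. C i l * u l))"
        using ij by (auto simp: G_def intro!: sum.neutral sum.cong)
      also have "\<dots> = X $$ (i, j)"
        using True ij u[of i] by (auto simp: X_def r_def less_Suc_eq)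
      finally show ?thesis .
    next
      case False
      have "(\<Sum>l<?n. G $$ (i, l) * F $$ (l, j)) = (\<Sum>l<?n. if j = l then G $$ (i, l) else 0)"
        by (intro sum.cong refl) (use False ij in \<open>auto simp: F_def\<close>)
      also have "\<dots> = X $$ (i, j)" using False ij by (simp add: G_def X_def del: sum.lessThan_Suc)
      finally show ?thesis .
    qed
    finally show "(G * F) $$ (i, j) = X $$ (i, j)" .
  qed (simp_all add: F_def G_def X_def)
  then have "Determinant.det (E * leading C ?n * F) = Determinant.det X" using G by simp
  then have "w k * Determinant.det (leading C ?n) * u k = Determinant.det X"
    using dE dF by (simp only: det_mult[OF mult_carrier_mat[OF cE leading_carrier] cF]
        det_mult[OF cE leading_carrier])
  \<comment> \<open>Row \<open>k\<close> of \<open>X\<close> has its only nonzero entry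
    \<open>t\<close> in column \<open>k + 1\<close>. After the deletion, column \<open>k\<close> has
    its only nonzero entry \<open>r\<close> in the last row. The first cofactor has odd index sum,
    the second an even one, hence the single minus sign.\<close>
  also have "Determinant.det X = (\<Sum>j<?n. X $$ (k, j) * cofactor X k j)"
    by (rule laplace_expansion_row[of _ ?n]) (simp_all add: X_def)
  also have "\<dots> = t * cofactor X k (Suc k)"
    by (simp add: X_def)
  also have "cofactor X k (Suc k) = - Determinant.det (mat_delete X k (Suc k))"
    by (simp add: cofactor_def)
  also have "Determinant.det (mat_delete X k (Suc k)) =
      (\<Sum>i<Suc k. mat_delete X k (Suc k) $$ (i, k) * cofactor (mat_delete X k (Suc k)) i k)"
    by (rule laplace_expansion_column[of _ "Suc k"]) (simp_all add: X_def mat_delete_def)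
  also have "\<dots> = r * cofactor (mat_delete X k (Suc k)) k k"
    by (simp add: X_def mat_delete_def)
  also have "mat_delete (mat_delete X k (Suc k)) k k = leading C k"
    by (rule eq_matI) (auto simp: X_def mat_delete_def)
  then have "cofactor (mat_delete X k (Suc k)) k k = Determinant.det (leading C k)"
    by (simp add: cofactor_def)
  finally show ?thesis unfolding t_def r_def by simp
qed

text \<open>For kernel vectors \<open>u\<close>, \<open>w\<close> with last entry 1,
  \<open>det_bordered\<close> reads \<open>P_(k+2)(c) = - t * r * P_k(c)\<close>. Both
  \<open>t\<close> and \<open>r\<close> are negative, because \<open>shifted\<close> negates the
  entries of \<open>T\<close> off the diagonal and the images under \<open>T\<close> and its
  transpose are positive at \<open>k + 1\<close>.\<close>

lemma charP_sturm:
  assumes T: "bidiagonal_product T" and c: "c > 0"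
    and root: "poly (charP T (Suc k)) c = 0" and nz: "poly (charP T k) c \<noteq> 0"
  shows "poly (charP T (Suc (Suc k))) c * poly (charP T k) c < 0"
proof -
  \<comment> \<open>Proved for a general matrix with the same characteristic polynomials, in order
    to be used for \<open>T\<close> and for its transpose.\<close>
  have pos: "\<exists>u. u k = 1 \<and> (\<forall>i\<le>k. (\<Sum>l\<le>k. shifted S c i l * u l) = 0) \<and>
      (\<Sum>l\<le>k. shifted S c (Suc k) l * u l) < 0"
    if S: "bidiagonal_product S" "charP S = charP T" for S
  proof -
    have "Determinant.det (leading (shifted S c) (Suc k)) = 0"
      "Determinant.det (leading (shifted S c) k) \<noteq> 0"
      using root nz S(2) by (simp_all add: poly_charP[symmetric])
    then obtain u where u: "u k = 1" "\<And>i. i \<le> k \<Longrightarrow> (\<Sum>l\<le>k. shifted S c i l * u l) = 0"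
      using kernel_exists by blast
    have "(\<Sum>l\<le>k. S i l * u l) = c * u i" if "i \<le> k" for i
      using sum_shifted[OF that, of S c u] u(2)[OF that] by simp
    then have "(\<Sum>l\<le>k. S (Suc k) l * u l) > 0"
      using bidiagonal_product_extension_pos[OF S(1), of u k c] u(1) c by simp
    then show ?thesis using u sum_shifted_offdiag[of k "Suc k" S c u] by auto
  qed
  obtain u where u: "u k = 1" "\<forall>i\<le>k. (\<Sum>l\<le>k. shifted T c i l * u l) = 0"
      "(\<Sum>l\<le>k. shifted T c (Suc k) l * u l) < 0"
    using pos[OF T] by auto
  have "charP (\<lambda>i j. T j i) = charP T" by (rule ext) (rule charP_transpose)
  then obtain w where w: "w k = 1" "\<forall>j\<le>k. (\<Sum>l\<le>k. shifted T c l j * w l) = 0"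
      "(\<Sum>l\<le>k. shifted T c l (Suc k) * w l) < 0"
    using pos[OF bidiagonal_product_transpose[OF T]]
    by (auto simp: shifted_transpose[of T])
  have "poly (charP T (Suc (Suc k))) c =
    - ((\<Sum>l\<le>k. shifted T c l (Suc k) * w l) * (\<Sum>l\<le>k. shifted T c (Suc k) l * u l) *
       poly (charP T k) c)"
    using det_bordered[of k "shifted T c" u w] u w by (simp add: poly_charP)
  then have "poly (charP T (Suc (Suc k))) c * poly (charP T k) c =
    - ((\<Sum>l\<le>k. shifted T c l (Suc k) * w l) * (\<Sum>l\<le>k. shifted T c (Suc k) l * u l) *
       (poly (charP T k) c)\<^sup>2)"
    by (simp add: power2_eq_square)
  moreover have "(\<Sum>l\<le>k. shifted T c l (Suc k) * w l) * (\<Sum>l\<le>k. shifted T c (Suc k) l * u l) *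
       (poly (charP T k) c)\<^sup>2 > 0"
    using u(3) w(3) nz by (intro mult_pos_pos mult_neg_neg) auto
  ultimately show ?thesis by linarith
qed

section \<open>Location of the roots\<close>

lemma monic_charP: "degree (charP T M) = M" "coeff (charP T M) M = 1"
  using degree_monic_char_poly[of "leading T M" M] by (simp_all add: charP_eq)

text \<open>Supplies the sign at the end point 0 of the last gap, and thereby the positivity of the
  smallest root.\<close>

lemma charP_0_sign:
  assumes "bidiagonal_product T"
  shows "(-1) ^ Suc N * poly (charP T (Suc N)) 0 > 0"
proof -
  have "leading (shifted T 0) (Suc N) = (-1) \<cdot>\<^sub>m trunc T N"
    by (rule eq_matI) (auto simp: shifted_def trunc_def)
  then have "poly (charP T (Suc N)) 0 = (-1) ^ Suc N * Determinant.det (trunc T N)"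
    by (simp add: poly_charP det_smult trunc_eq_leading)
  then show ?thesis using det_trunc_pos[OF assms, of N]
    by (simp add: power_mult_distrib[symmetric])
qed

lemma monic_eq_prod_linear:
  fixes Q :: "real poly"
  assumes "degree Q = Suc N" and "coeff Q (Suc N) = 1"
    and "inj_on f {..N}" and "\<And>k. k \<le> N \<Longrightarrow> poly Q (f k) = 0"
  shows "Q = (\<Prod>i\<le>N. [:- f i, 1:])"
proof -
  let ?R = "\<Prod>i\<le>N. [:- f i, 1:]"
  have deg: "degree ?R = Suc N" by (simp add: degree_prod_eq_sum_degree)
  have "lead_coeff ?R = 1" by (subst lead_coeff_prod) simp
  then have "coeff ?R (Suc N) = 1" using deg by simp
  show "Q = ?R"
  proof (rule poly_eqI_degree_lead_coeff[of _ "Suc N" _ "f ` {..N}"])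
    show "poly Q z = poly ?R z" if "z \<in> f ` {..N}" for z
      using that assms(4) by (auto simp: poly_prod intro!: prod_zero)
  qed (use assms deg \<open>coeff ?R (Suc N) = 1\<close> in \<open>auto simp: card_image\<close>)
qed

lemma monic_eq_prod_roots:
  fixes Q :: "real poly"
  assumes "degree Q = Suc N" and "coeff Q (Suc N) = 1"
    and "inj_on f {..N}" and "\<And>k. k \<le> N \<Longrightarrow> poly Q (f k) = 0"
  shows "poly Q x = (\<Prod>i\<le>N. x - f i)"
  by (subst monic_eq_prod_linear[OF assms]) (simp_all add: poly_prod)

lemma pderiv_prod_linear_root:
  fixes f :: "nat \<Rightarrow> real"
  assumes "inj_on f {..N}" and k: "k \<le> N"
  shows "poly (pderiv (\<Prod>i\<le>N. [:- f i, 1:])) (f k) \<noteq> 0"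
proof -
  have "(\<Prod>i\<le>N. [:- f i, 1:]) = [:- f k, 1:] * (\<Prod>i\<in>{..N} - {k}. [:- f i, 1:])"
    using k by (intro prod.remove) auto
  then have "poly (pderiv (\<Prod>i\<le>N. [:- f i, 1:])) (f k) = (\<Prod>i\<in>{..N} - {k}. f k - f i)"
    by (simp only: pderiv_mult poly_add poly_mult poly_prod) (simp add: pderiv_pCons)
  then show ?thesis using assms by (auto simp: inj_on_def)
qed

lemma prod_sign:
  fixes f :: "nat \<Rightarrow> real"
  assumes k: "k \<le> Suc N" and "\<And>i. i < k \<Longrightarrow> x < f i" and "\<And>i. k \<le> i \<Longrightarrow> i \<le> N \<Longrightarrow> f i < x"
  shows "(-1) ^ k * (\<Prod>i\<le>N. x - f i) > 0"
proof -
  have "(\<Prod>i\<le>N. x - f i) = (\<Prod>i<k. x - f i) * (\<Prod>i\<in>{k..N}. x - f i)"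
    using k by (subst prod.union_disjoint[symmetric]) (auto intro!: prod.cong)
  also have "(\<Prod>i<k. x - f i) = (-1) ^ k * (\<Prod>i<k. f i - x)"
    using prod.distrib[of "\<lambda>_. -1" "\<lambda>i. f i - x" "{..<k}"] by (simp add: algebra_simps)
  finally have "(-1) ^ k * (\<Prod>i\<le>N. x - f i) = (\<Prod>i<k. f i - x) * (\<Prod>i\<in>{k..N}. x - f i)"
    by (simp add: power_mult_distrib[symmetric] mult.assoc[symmetric])
  also have "\<dots> > 0" using assms by (intro mult_pos_pos prod_pos) auto
  finally show ?thesis .
qed

text \<open>At the \<open>N + 1\<close> roots of \<open>P_(N+1)\<close> the values of
  \<open>P_N\<close> alternate, and by \<open>charP_sturm\<close> those of \<open>P_(N+2)\<close>
  alternate in the opposite way. With the sign at 0 and the growth at infinity, each of the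
  \<open>N + 2\<close> gaps receives a root of \<open>P_(N+2)\<close>.\<close>

lemma charP_interlacing:
  assumes T: "bidiagonal_product T"
  shows "\<exists>f. (\<forall>i j. i < j \<longrightarrow> j \<le> N \<longrightarrow> f j < f i) \<and>
    (\<forall>k\<le>N. f k > 0 \<and> poly (charP T (Suc N)) (f k) = 0 \<and> (-1) ^ k * poly (charP T N) (f k) > 0)"
proof (induction N)
  case 0
  let ?c = "T 0 0"
  have d: "Determinant.det (leading C (Suc 0)) = C 0 0" for C :: "nat \<Rightarrow> nat \<Rightarrow> real"
    by (simp add: det_single leading_def)
  have "poly (charP T (Suc 0)) ?c = 0" by (simp add: poly_charP d shifted_def)
  moreover have "T 0 0 > 0" using det_trunc_pos[OF T, of 0] by (simp add: trunc_eq_leading d)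
  moreover have "charP T 0 = 1" by (simp add: charP_def)
  ultimately show ?case by (intro exI[of _ "\<lambda>_. ?c"]) auto
next
  case (Suc N)
  then obtain f where dec: "\<And>i j. i < j \<Longrightarrow> j \<le> N \<Longrightarrow> f j < f i"
    and pos: "\<And>k. k \<le> N \<Longrightarrow> f k > 0" and root: "\<And>k. k \<le> N \<Longrightarrow> poly (charP T (Suc N)) (f k) = 0"
    and alt: "\<And>k. k \<le> N \<Longrightarrow> (-1) ^ k * poly (charP T N) (f k) > 0" by blast
  let ?P = "charP T (Suc (Suc N))"
  have neg: "(-1) ^ k * poly ?P (f k) < 0" if k: "k \<le> N" for k
  proof -
    have "poly (charP T N) (f k) \<noteq> 0" using alt[OF k] by auto
    then have "poly ?P (f k) * poly (charP T N) (f k) < 0"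
      using charP_sturm[OF T pos[OF k] root[OF k]] by blast
    then show ?thesis using alt[OF k] by (cases "even k") (auto simp: mult_less_0_iff)
  qed
  have ex: "\<exists>g>0. poly ?P g = 0 \<and> (\<forall>i<k. g < f i) \<and> (\<forall>i. k \<le> i \<longrightarrow> i \<le> N \<longrightarrow> f i < g)"
    if k: "k \<le> Suc N" for k
  proof -
    \<comment> \<open>The gaps are numbered from the right: \<open>a\<close> is the left end of gap
      \<open>k\<close>, namely \<open>f k\<close>, or 0 for the last gap. The right end
      \<open>b\<close> below is \<open>f (k - 1)\<close>, or a point far to the right if
      \<open>k = 0\<close>.\<close>
    define a where "a = (if k = Suc N then 0 else f k)"
    have a: "(-1) ^ k * poly ?P a < 0"
      using charP_0_sign[OF T, of "Suc N"] neg[of k] k by (auto simp: a_def)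
    have a0: "a \<ge> 0" using pos[of k] k by (auto simp: a_def)
    have "\<exists>b>a. (-1) ^ k * poly ?P b > 0 \<and> (k > 0 \<longrightarrow> b = f (k - 1))"
    proof (cases k)
      case 0
      have "lead_coeff ?P > 0" using monic_charP[of T "Suc (Suc N)"] by simp
      then obtain n where n: "\<And>x. x \<ge> n \<Longrightarrow> poly ?P x \<ge> lead_coeff ?P"
        using poly_pinfty_gt_lc by blast
      let ?b = "max n (a + 1)"
      have "poly ?P ?b > 0" using n[of ?b] \<open>lead_coeff ?P > 0\<close> by simp
      then show ?thesis using 0 by (intro exI[of _ ?b]) auto
    next
      case (Suc j)
      have "f j > a" using dec[of j k] pos[of j] k Suc by (auto simp: a_def)
      moreover have "(-1) ^ k * poly ?P (f j) > 0" using neg[of j] k Suc by simp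
      ultimately show ?thesis using Suc by auto
    qed
    then obtain b where b: "b > a" "(-1) ^ k * poly ?P b > 0" "k > 0 \<longrightarrow> b = f (k - 1)" by blast
    have "poly ?P a * poly ?P b < 0" using a b(2) by (cases "even k") (auto simp: mult_less_0_iff)
    then obtain g where g: "a < g" "g < b" "poly ?P g = 0" using poly_IVT[OF b(1)] by blast
    have "g < f i" if "i < k" for i
    proof -
      have "f (k - 1) \<le> f i" using dec[of i "k - 1"] that k
        by (cases "i = k - 1") (auto intro!: less_imp_le)
      then show ?thesis using g b that by auto
    qed
    moreover have "f i < g" if "k \<le> i" "i \<le> N" for i
    proof -
      have "f i \<le> f k" using dec[of k i] that by (cases "i = k") auto
      then show ?thesis using g that by (auto simp: a_def)
    qed
    ultimately show ?thesis using g a0 by (intro exI[of _ g]) auto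
  qed
  then obtain g where g: "\<And>k. k \<le> Suc N \<Longrightarrow> g k > 0 \<and> poly ?P (g k) = 0 \<and>
      (\<forall>i<k. g k < f i) \<and> (\<forall>i. k \<le> i \<longrightarrow> i \<le> N \<longrightarrow> f i < g k)"
    by metis
  have "g j < g i" if "i < j" "j \<le> Suc N" for i j
  proof -
    have "i \<le> N" using that by simp
    then have "f i < g i" and "g j < f i" using g[of i] g[of j] that by auto
    then show ?thesis by simp
  qed
  \<comment> \<open>Exactly the \<open>k\<close> roots \<open>f 0, ..., f (k - 1)\<close> exceed
    \<open>g k\<close>, so the factorization into linear factors has \<open>k\<close> negative
    factors there. This restores the alternation.\<close>
  moreover have "(-1) ^ k * poly (charP T (Suc N)) (g k) > 0" if "k \<le> Suc N" for k
  proof -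
    have "inj_on f {..N}" using dec by (intro linorder_inj_onI) (auto, metis order.irrefl)
    then have "poly (charP T (Suc N)) (g k) = (\<Prod>i\<le>N. g k - f i)"
      using root by (intro monic_eq_prod_roots) (auto simp: monic_charP)
    then show ?thesis using prod_sign[OF that, of "g k" f] g[OF that] by simp
  qed
  ultimately show ?case using g by (intro exI[of _ g]) auto
qed

text \<open>The \<open>N + 1\<close> interlacing roots exhaust the degree of the characteristic
  polynomial, so they are the whole spectrum, and the reversed sorted list that defines
  \<open>eigval\<close> enumerates them.\<close>

lemma eigval_charP:
  assumes T: "bidiagonal_product T"
  shows "\<And>i j. i < j \<Longrightarrow> j \<le> N \<Longrightarrow> eigval T N j < eigval T N i"
    and "\<And>k. k \<le> N \<Longrightarrow> eigval T N k > 0"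
    and "\<And>k. k \<le> N \<Longrightarrow> poly (charP T (Suc N)) (eigval T N k) = 0"
    and "\<And>k. k \<le> N \<Longrightarrow> poly (charP T N) (eigval T N k) \<noteq> 0"
    and "\<And>k. k \<le> N \<Longrightarrow> poly (pderiv (charP T (Suc N))) (eigval T N k) \<noteq> 0"
proof -
  obtain f where dec: "\<And>i j. i < j \<Longrightarrow> j \<le> N \<Longrightarrow> f j < f i"
    and pos: "\<And>k. k \<le> N \<Longrightarrow> f k > 0" and root: "\<And>k. k \<le> N \<Longrightarrow> poly (charP T (Suc N)) (f k) = 0"
    and alt: "\<And>k. k \<le> N \<Longrightarrow> (-1) ^ k * poly (charP T N) (f k) > 0"
    using charP_interlacing[OF T, of N] by blast
  have inj: "inj_on f {..N}" using dec by (intro linorder_inj_onI) (auto, metis order.irrefl)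
  have P: "poly (charP T (Suc N)) x = (\<Prod>i\<le>N. x - f i)" for x
    using root inj by (intro monic_eq_prod_roots) (auto simp: monic_charP)
  have "{x. eigenvalue (trunc T N) x} = {x. poly (charP T (Suc N)) x = 0}"
    using eigenvalue_root_char_poly[of "trunc T N" "Suc N"] by (simp add: charP_def)
  also have "\<dots> = f ` {..N}" by (auto simp: P)
  finally have set: "{x. eigenvalue (trunc T N) x} = f ` {..N}" .
  have "sorted_list_of_set (f ` {..N}) = rev (map f [0..<Suc N])"
  proof (rule sorted_distinct_set_unique)
    have "f j \<le> f i" if "i \<le> j" "j \<le> N" for i j
      using dec[of i j] that by (cases "i = j") auto
    then show "sorted (rev (map f [0..<Suc N]))"
      unfolding sorted_rev_iff_nth_mono by (simp del: upt_Suc)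
    show "distinct (rev (map f [0..<Suc N]))"
      using inj by (auto simp: distinct_map lessThan_Suc_atMost atLeast0LessThan simp del: upt_Suc)
  qed (auto simp: lessThan_Suc_atMost atLeast0LessThan simp del: upt_Suc)
  then have eq: "eigval T N k = f k" if "k \<le> N" for k
    unfolding eigval_def set using that by (simp del: upt_Suc)
  show "eigval T N j < eigval T N i" if "i < j" "j \<le> N" for i j
    using dec[OF that] eq[of i] eq[of j] that by simp
  fix k
  assume k: "k \<le> N"
  show "eigval T N k > 0" using pos[OF k] eq[OF k] by simp
  show "poly (charP T (Suc N)) (eigval T N k) = 0" using root[OF k] eq[OF k] by simp
  show "poly (charP T N) (eigval T N k) \<noteq> 0" using alt[OF k] eq[OF k] by auto
  have "charP T (Suc N) = (\<Prod>i\<le>N. [:- f i, 1:])"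
    using root inj by (intro monic_eq_prod_linear) (auto simp: monic_charP)
  then show "poly (pderiv (charP T (Suc N))) (eigval T N k) \<noteq> 0"
    using pderiv_prod_linear_root[OF inj k] eq[OF k] by simp
qed

text \<open>Let \<open>a\<close> be the last column of the adjugate of \<open>xI - T^[N]\<close>.
  Multiplying the product of this matrix with \<open>a\<close> by \<open>w\<close> from the left
  gives \<open>(x - c) * (w a) = w_N * P_(N+1)\<close>, and differentiating at \<open>c\<close>
  gives \<open>w a(c) = w_N * P_(N+1)'(c)\<close>. On the other hand \<open>a(c)\<close> lies in the
  kernel and has last entry \<open>P_N(c)\<close>, so it is proportional to
  \<open>u\<close>.\<close>

lemma pderiv_charP:
  assumes u: "\<And>i. i \<le> N \<Longrightarrow> (\<Sum>l\<le>N. T i l * u l) = c * u i"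
    and w: "\<And>j. j \<le> N \<Longrightarrow> (\<Sum>l\<le>N. w l * T l j) = c * w j"
    and root: "poly (charP T (Suc N)) c = 0" and nz: "poly (charP T N) c \<noteq> 0"
  shows "poly (pderiv (charP T (Suc N))) c * w N * u N =
    poly (charP T N) c * (\<Sum>i\<le>N. w i * u i)"
proof -
  let ?n = "Suc N"
  define Cp where "Cp = char_poly_matrix (leading T ?n)"
  have Cp: "Cp \<in> carrier_mat ?n ?n" by (simp add: Cp_def)
  define a where "a i = adj_mat Cp $$ (i, N)" for i
  have Cp_index: "Cp $$ (i, j) = [:- T i j, if i = j then 1 else 0:]" if "i < ?n" "j < ?n" for i j
    using that by (simp add: Cp_def char_poly_matrix_def)
  have P: "charP T ?n = Determinant.det Cp" by (simp add: charP_eq char_poly_def Cp_def)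
  have adj: "(\<Sum>i\<le>N. Cp $$ (j, i) * a i) = (if j = N then charP T ?n else 0)" if j: "j \<le> N" for j
  proof -
    have "(Cp * adj_mat Cp) $$ (j, N) = (\<Sum>i\<le>N. Cp $$ (j, i) * a i)"
      using j Cp adj_mat(1)[OF Cp]
      by (simp add: scalar_prod_def a_def atLeast0LessThan lessThan_Suc_atMost)
    then show ?thesis using adj_mat(2)[OF Cp] j by (auto simp: P)
  qed
  let ?g = "\<Sum>i\<le>N. [:w i:] * a i"
  have "[:- c, 1:] * ?g = (\<Sum>i\<le>N. (\<Sum>j\<le>N. [:w j:] * Cp $$ (j, i)) * a i)"
    unfolding sum_distrib_left
  proof (intro sum.cong refl)
    fix i assume i: "i \<in> {..N}"
    have "(\<Sum>j\<le>N. [:w j:] * Cp $$ (j, i)) = (\<Sum>j\<le>N. [:- (w j * T j i), if j = i then w j else 0:])"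
      using i by (intro sum.cong refl) (simp add: Cp_index)
    also have "\<dots> = [:- (\<Sum>j\<le>N. w j * T j i), w i:]"
    proof (rule poly_eqI)
      fix d
      show "coeff (\<Sum>j\<le>N. [:- (w j * T j i), if j = i then w j else 0:]) d =
        coeff [:- (\<Sum>j\<le>N. w j * T j i), w i:] d"
        using i by (cases d; cases "d - 1") (auto simp: coeff_sum sum_negf coeff_pCons)
    qed
    also have "\<dots> = [:- c, 1:] * [:w i:]" using i w[of i] by simp
    finally show "[:- c, 1:] * ([:w i:] * a i) = (\<Sum>j\<le>N. [:w j:] * Cp $$ (j, i)) * a i"
      by (simp only: mult.assoc)
  qed
  also have "\<dots> = (\<Sum>j\<le>N. [:w j:] * (\<Sum>i\<le>N. Cp $$ (j, i) * a i))"
    unfolding sum_distrib_right sum_distrib_left by (subst sum.swap) (simp only: mult.assoc)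
  also have "\<dots> = (\<Sum>j\<le>N. if j = N then [:w j:] * charP T ?n else 0)"
    by (intro sum.cong refl) (simp add: adj)
  also have "\<dots> = [:w N:] * charP T ?n" by simp
  finally have "pderiv ([:- c, 1:] * ?g) = pderiv ([:w N:] * charP T ?n)" by (rule arg_cong)
  then have "poly (pderiv ([:- c, 1:] * ?g)) c = poly (pderiv ([:w N:] * charP T ?n)) c" by simp
  then have 1: "poly ?g c = w N * poly (pderiv (charP T ?n)) c"
    unfolding pderiv_mult poly_add poly_mult by (simp add: pderiv_pCons)
  have "mat_delete Cp N N = char_poly_matrix (leading T N)"
    by (rule eq_matI) (auto simp: Cp_def char_poly_matrix_def mat_delete_def)
  then have aN: "a N = charP T N"
    using Cp by (simp add: a_def adj_mat_def cofactor_def charP_eq char_poly_def)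
  have ker: "(\<Sum>l\<le>N. shifted T c i l * poly (a l) c) = 0" if "i \<le> N" for i
  proof -
    have "(\<Sum>l\<le>N. shifted T c i l * poly (a l) c) = poly (\<Sum>l\<le>N. Cp $$ (i, l) * a l) c"
      using that by (simp add: poly_sum) (intro sum.cong; simp add: Cp_index shifted_def)
    then show ?thesis using adj[OF that] root by simp
  qed
  have ku: "(\<Sum>l\<le>N. shifted T c i l * u l) = 0" if "i \<le> N" for i
    using sum_shifted[OF that, of T c u] u[OF that] by simp
  have *: "u N * poly (a i) c = poly (charP T N) c * u i" if "i \<le> N" for i
    using kernel_unique[of "shifted T c" N u "\<lambda>l. poly (a l) c" i] nz ker ku that
    by (simp add: poly_charP aN)
  have "poly (pderiv (charP T ?n)) c * w N * u N = u N * poly ?g c" using 1 by simp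
  also have "\<dots> = (\<Sum>i\<le>N. w i * (u N * poly (a i) c))"
    by (simp add: poly_sum sum_distrib_left mult.left_commute)
  also have "\<dots> = (\<Sum>i\<le>N. w i * (poly (charP T N) c * u i))" by (intro sum.cong) (auto simp: *)
  also have "\<dots> = poly (charP T N) c * (\<Sum>i\<le>N. w i * u i)"
    by (simp add: sum_distrib_left mult.left_commute)
  finally show ?thesis .
qed

section \<open>Determinants of recursion polynomials\<close>

lemma mat_inverse_nonsingular:
  fixes A :: "real mat"
  assumes A: "A \<in> carrier_mat n n" and det: "Determinant.det A \<noteq> 0"
  obtains D where "mat_inverse A = Some D" and "D * A = 1\<^sub>m n" and "D \<in> carrier_mat n n"
proof (cases "mat_inverse A")
  case None
  then show ?thesis using mat_inverse(1)[OF A, where b = "()"] det_non_zero_imp_unit[OF A det, where b = "()"]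
    by blast
next
  case (Some D)
  then show ?thesis using mat_inverse(2)[OF A] that by blast
qed

text \<open>For the polynomials \<open>A\<close> the matrix \<open>S\<close> is \<open>T\<close>, for the polynomials \<open>B\<close> it is the transpose of \<open>T\<close>.\<close>

locale banded_recursion =
  fixes d :: nat and S :: "nat \<Rightarrow> nat \<Rightarrow> real" and \<nu> :: "real mat"
    and C :: "nat \<Rightarrow> nat \<Rightarrow> real poly"
  assumes d: "1 \<le> d"
    and band: "\<And>l n. n + d < l \<Longrightarrow> S l n = 0"
    and \<nu>: "lower_unitriangular d \<nu>"
    and init: "\<And>c n. c < d \<Longrightarrow> n < d \<Longrightarrow> C c n = [:\<nu> $$ (n, c):]"
    and rec: "\<And>c n x. c < d \<Longrightarrow> (\<Sum>l\<le>n + d. S l n * poly (C c l) x) = x * poly (C c n) x"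
begin

lemma det_\<nu>: "Determinant.det \<nu> = 1"
proof -
  have "\<nu> \<in> carrier_mat d d" using \<nu> by (simp add: lower_unitriangular_def)
  then have "Determinant.det \<nu> = prod_list (diag_mat \<nu>)"
    by (intro det_lower_triangular[of d]) (use \<nu> in \<open>auto simp: lower_unitriangular_def\<close>)
  also have "\<dots> = 1"
    unfolding prod_list_diag_prod using \<nu> by (intro prod.neutral) (auto simp: lower_unitriangular_def)
  finally show ?thesis .
qed

lemma sum_band:
  assumes "n + d \<le> K"
  shows "(\<Sum>l\<le>K. S l n * f l) = (\<Sum>l\<le>n + d. S l n * f l)"
  using assms band by (intro sum.mono_neutral_right) auto

text \<open>The matrix \<open>Z\<close> holds the recursion polynomials up to index \<open>N + d - 1\<close> below an identity block,
  and \<open>Y\<close> holds \<open>N\<close> columns of the recursion to the right of an identity block, so that the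
  recursion makes \<open>Z * Y\<close> block triangular up to a swap of columns.\<close>

lemma rec_det_eq_charP:
  "poly (rec_det d C N N) x * (-1) ^ ((d - 1) * N) * (\<Prod>i<N. S (d + i) i) = poly (charP S N) x"
proof -
  let ?m = "N + d"
  define a where "a c l = poly (C c l) x" for c l
  define Z where "Z = leading (\<lambda>i l. if i < N then if i = l then 1 else 0 else a (i - N) l) ?m"
  define Y where "Y = leading (\<lambda>l j. if j < d then if l = j then 1 else 0
    else S l (j - d) - (if l = j - d then x else 0)) ?m"
  have cZ: "Z \<in> carrier_mat ?m ?m" and cY: "Y \<in> carrier_mat ?m ?m"
    by (simp_all add: Z_def Y_def)
  have \<nu>c: "\<nu> \<in> carrier_mat d d" using \<nu> by (simp add: lower_unitriangular_def)
  have R: "poly (rec_det d C N N) x = Determinant.det (leading (\<lambda>i c. a c (N + i)) d)"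
    unfolding rec_det_def
    by (rule poly_det_cong[of _ d]) (auto simp: a_def)
  \<comment> \<open>For \<open>n = N\<close> the rows of \<open>rec_det\<close> have the consecutive
    indices \<open>N, ..., N + d - 1\<close>, so its matrix is the transpose of the lower right
    block of \<open>Z\<close>.\<close>
  have "Z = four_block_mat (1\<^sub>m N) (0\<^sub>m N d) (Matrix.mat d N (\<lambda>(c, l). a c l))
      (leading (\<lambda>c i. a c (N + i)) d)"
    by (rule eq_matI) (auto simp: Z_def)
  then have "Determinant.det Z = Determinant.det (leading (\<lambda>c i. a c (N + i)) d)"
    by (simp add: det_four_block_mat_upper_right_zero[of _ N _ d])
  then have dZ: "Determinant.det Z = poly (rec_det d C N N) x"
    unfolding R using det_leading_transpose[of "\<lambda>i c. a c (N + i)" d] by simp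
  \<comment> \<open>By the band condition, column \<open>j >= d\<close> of \<open>Y\<close> ends at
    row \<open>j\<close>. Its diagonal entry \<open>S j (j - d)\<close> carries no \<open>x\<close>
    because \<open>d >= 1\<close>.\<close>
  have "Determinant.det Y = prod_list (diag_mat Y)"
  proof (rule det_upper_triangular[OF _ cY], unfold upper_triangular_def, intro allI impI)
    fix i j
    assume ij: "i < dim_row Y" "j < i"
    then have "S i (j - d) = 0" if "\<not> j < d" using band that by simp
    then show "Y $$ (i, j) = 0" using ij by (auto simp: Y_def)
  qed
  also have "\<dots> = (\<Prod>i<?m. Y $$ (i, i))"
    using cY by (simp add: prod_list_diag_prod atLeast0LessThan)
  also have "\<dots> = (\<Prod>i<d. Y $$ (i, i)) * (\<Prod>i\<in>{d..<?m}. Y $$ (i, i))"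
    by (subst prod.union_disjoint[symmetric]) (auto intro!: prod.cong)
  also have "(\<Prod>i<d. Y $$ (i, i)) = 1" by (intro prod.neutral) (auto simp: Y_def)
  also have "(\<Prod>i\<in>{d..<?m}. Y $$ (i, i)) = (\<Prod>i<N. S (d + i) i)"
    by (rule prod.reindex_bij_witness[of _ "\<lambda>i. i + d" "\<lambda>i. i - d"])
       (use d in \<open>auto simp: Y_def add.commute\<close>)
  finally have dY: "Determinant.det Y = (\<Prod>i<N. S (d + i) i)" by simp
  \<comment> \<open>The lower rows of \<open>Z\<close> meet the identity columns of \<open>Y\<close>
    in the initial values, that is in \<nu>, and the other columns of \<open>Y\<close> in the
    recursion, that is in 0.\<close>
  have ZY: "(Z * Y) $$ (i, j) = (if i < N then Y $$ (i, j) else if j < d then \<nu> $$ (j, i - N) else 0)"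
    if ij: "i < ?m" "j < ?m" for i j
  proof -
    have s: "(Z * Y) $$ (i, j) = (\<Sum>l<?m. Z $$ (i, l) * Y $$ (l, j))"
      using ij cZ cY by (simp add: scalar_prod_def atLeast0LessThan)
    show ?thesis
    proof (cases "i < N")
      case True
      have "(\<Sum>l<?m. Z $$ (i, l) * Y $$ (l, j)) = (\<Sum>l<?m. if i = l then Y $$ (l, j) else 0)"
        by (intro sum.cong refl) (use True ij in \<open>auto simp: Z_def\<close>)
      then show ?thesis using s True ij by simp
    next
      case False
      then have c: "i - N < d" using ij by auto
      show ?thesis
      proof (cases "j < d")
        case True
        have "(\<Sum>l<?m. Z $$ (i, l) * Y $$ (l, j)) = (\<Sum>l<?m. if j = l then a (i - N) l else 0)"
          by (intro sum.cong refl) (use False True ij in \<open>auto simp: Z_def Y_def\<close>)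
        also have "\<dots> = \<nu> $$ (j, i - N)" using True c ij by (simp add: a_def init)
        finally show ?thesis using s False True by simp
      next
        case j: False
        let ?n = "j - d"
        have n: "?n < N" "?n < ?m" "?n + d < ?m" using j ij by auto
        have "(\<Sum>l<?m. Z $$ (i, l) * Y $$ (l, j)) =
          (\<Sum>l<?m. S l ?n * a (i - N) l - (if ?n = l then x * a (i - N) l else 0))"
          by (intro sum.cong refl) (use False j ij in \<open>auto simp: Z_def Y_def algebra_simps\<close>)
        also have "\<dots> = (\<Sum>l<?m. S l ?n * a (i - N) l) - x * a (i - N) ?n"
          using n by (simp add: sum_subtractf)
        also have "(\<Sum>l<?m. S l ?n * a (i - N) l) = (\<Sum>l\<le>?m - 1. S l ?n * a (i - N) l)"
          using d by (intro sum.cong) auto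
        also have "\<dots> = (\<Sum>l\<le>?n + d. S l ?n * a (i - N) l)"
          by (rule sum_band) (use n in auto)
        also have "\<dots> = x * a (i - N) ?n" using rec[OF c] by (simp add: a_def)
        finally show ?thesis using s False j by simp
      qed
    qed
  qed
  \<comment> \<open>Moving the first \<open>d\<close> columns to the right end costs
    \<open>(-1) ^ (N * d)\<close> and leaves a block upper triangular matrix.\<close>
  let ?W = "Matrix.mat ?m ?m (\<lambda>(i, j). (Z * Y) $$ (i, if j < N then j + d else j - N))"
  have "Determinant.det (Z * Y) = (-1) ^ (N * d) * Determinant.det ?W"
    by (rule det_swap_cols) (use cZ cY in auto)
  also have "?W = four_block_mat (leading (\<lambda>i j. - shifted S x i j) N)
      (Matrix.mat N d (\<lambda>(i, j). Y $$ (i, j))) (0\<^sub>m d N) (transpose_mat \<nu>)"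
    (is "_ = ?V")
  proof (rule eq_matI)
    fix i j
    assume "i < dim_row ?V" "j < dim_col ?V"
    then have ij: "i < ?m" "j < ?m" using \<nu>c by auto
    define j' where "j' = (if j < N then j + d else j - N)"
    have j': "j' < ?m" using ij by (auto simp: j'_def)
    have W: "?W $$ (i, j) =
        (if i < N then Y $$ (i, j') else if j' < d then \<nu> $$ (j', i - N) else 0)"
      using ij ZY[OF ij(1) j'] by (simp add: j'_def)
    show "?W $$ (i, j) = ?V $$ (i, j)"
    proof (cases "i < N")
      case True
      then show ?thesis unfolding W using \<nu>c ij j' by (auto simp: Y_def shifted_def j'_def)
    next
      case False
      then show ?thesis unfolding W using \<nu>c ij by (auto simp: j'_def)
    qed
  qed (use \<nu>c in auto)
  also have "Determinant.det ?V =
      Determinant.det (leading (\<lambda>i j. - shifted S x i j) N) * Determinant.det (transpose_mat \<nu>)"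
    by (rule det_four_block_mat_lower_left_zero[of _ N _ d]) (use \<nu>c in auto)
  also have "Determinant.det (transpose_mat \<nu>) = 1"
    using Determinant.det_transpose[OF \<nu>c] det_\<nu> by simp
  also have "leading (\<lambda>i j. - shifted S x i j) N = (-1) \<cdot>\<^sub>m leading (shifted S x) N"
    by (rule eq_matI) auto
  also have "Determinant.det \<dots> = (-1) ^ N * poly (charP S N) x"
    by (simp add: det_smult poly_charP)
  finally have "poly (rec_det d C N N) x * (\<Prod>i<N. S (d + i) i) =
      (-1) ^ (N * d) * ((-1) ^ N * poly (charP S N) x)"
    using dZ dY det_mult[OF cZ cY] by simp
  then have "poly (rec_det d C N N) x * (-1) ^ ((d - 1) * N) * (\<Prod>i<N. S (d + i) i) =
      ((-1) ^ ((d - 1) * N) * (-1) ^ (N * d) * (-1) ^ N) * poly (charP S N) x"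
    by (simp add: mult.commute mult.left_commute)
  \<comment> \<open>The exponents add up to \<open>2 * N * d\<close>.\<close>
  also have "(-1) ^ ((d - 1) * N) * (-1) ^ (N * d) * (-1) ^ N = (1 :: real)"
    using d by (cases d) (auto simp: power_add[symmetric] algebra_simps)
  finally show ?thesis by simp
qed

text \<open>Only the first row depends on \<open>n\<close>, so expansion along it has cofactors
  independent of \<open>n\<close>. As a sequence in \<open>n\<close> the determinant is thus a fixed
  combination of the recursion polynomials and inherits their recursion.\<close>

lemma rec_det_expansion:
  obtains K where "\<And>n. rec_det d C n N = (\<Sum>c<d. C c n * K c)"
proof
  fix n
  let ?M = "\<lambda>n. Matrix.mat d d (\<lambda>(i, c). C c (if i = 0 then n else N + i))"
  have "rec_det d C n N = (\<Sum>c<d. ?M n $$ (0, c) * cofactor (?M n) 0 c)"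
    unfolding rec_det_def by (rule laplace_expansion_row) (use d in auto)
  also have "\<dots> = (\<Sum>c<d. C c n * cofactor (?M 0) 0 c)"
  proof (intro sum.cong refl)
    fix c assume c: "c \<in> {..<d}"
    have "mat_delete (?M n) 0 c = mat_delete (?M 0) 0 c"
      by (rule eq_matI) (auto simp: mat_delete_def)
    then show "?M n $$ (0, c) * cofactor (?M n) 0 c = C c n * cofactor (?M 0) 0 c"
      using c d by (auto simp: cofactor_def)
  qed
  finally show "rec_det d C n N = (\<Sum>c<d. C c n * cofactor (?M 0) 0 c)" .
qed

lemma rec_det_eq_0:
  assumes "N < n" and "n < N + d"
  shows "rec_det d C n N = 0"
  unfolding rec_det_def
  by (rule det_identical_rows[of _ d 0 "n - N"]) (use assms in \<open>auto intro!: eq_vecI\<close>)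

lemma rec_det_recursion:
  "(\<Sum>l\<le>n + d. S l n * poly (rec_det d C l N) x) = x * poly (rec_det d C n N) x"
proof -
  obtain K where K: "\<And>n. rec_det d C n N = (\<Sum>c<d. C c n * K c)" using rec_det_expansion by blast
  have "(\<Sum>l\<le>n + d. S l n * poly (rec_det d C l N) x) =
      (\<Sum>c<d. (\<Sum>l\<le>n + d. S l n * poly (C c l) x) * poly (K c) x)"
    unfolding K poly_sum poly_mult sum_distrib_left sum_distrib_right
    by (subst sum.swap) (simp only: mult.assoc)
  also have "\<dots> = x * poly (rec_det d C n N) x"
    by (simp add: K poly_sum rec sum_distrib_left mult.assoc)
  finally show ?thesis .
qed

text \<open>For \<open>n < N\<close> the recursion reaches at most index \<open>N + d - 1\<close>,
  and the determinants with index beyond \<open>N\<close> vanish there. Row \<open>N\<close> would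
  reach \<open>N + d\<close>, which \<open>rec_det_eq_0\<close> does not cover; it is recovered from
  the singularity of the matrix: a true kernel vector exists and agrees, up to scaling, with any
  solution of the first \<open>N\<close> rows.\<close>

lemma rec_det_eigenvector:
  assumes root: "poly (charP S (Suc N)) x = 0" and nz: "poly (charP S N) x \<noteq> 0" and n: "n \<le> N"
  shows "(\<Sum>l\<le>N. S l n * poly (rec_det d C l N) x) = x * poly (rec_det d C n N) x"
proof -
  let ?v = "\<lambda>l. poly (rec_det d C l N) x"
  let ?S = "shifted (\<lambda>i j. S j i) x"
  have v: "(\<Sum>l\<le>N. ?S n l * ?v l) = 0" if "n < N" for n
  proof -
    have "x * ?v n = (\<Sum>l\<le>N + (d - 1). S l n * ?v l)"
      using rec_det_recursion[of n N x] sum_band[of n "N + (d - 1)" ?v] that by simp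
    also have "\<dots> = (\<Sum>l\<le>N. S l n * ?v l)"
      by (intro sum.mono_neutral_right) (auto simp: rec_det_eq_0)
    finally show ?thesis
      by (subst sum_shifted) (use that in simp_all)
  qed
  have "Determinant.det (leading ?S (Suc N)) = 0" and sub: "Determinant.det (leading ?S N) \<noteq> 0"
    using root nz by (simp_all only: poly_charP[symmetric] charP_transpose[of S] not_False_eq_True)
  then obtain u where u: "u N = 1" "\<And>i. i \<le> N \<Longrightarrow> (\<Sum>l\<le>N. ?S i l * u l) = 0"
    using kernel_exists by blast
  have vu: "?v i = ?v N * u i" if "i \<le> N" for i
    using kernel_unique[OF sub _ v that, of u] u by simp
  have "(\<Sum>l\<le>N. ?S n l * ?v l) = (\<Sum>l\<le>N. ?v N * (?S n l * u l))"
  proof (rule sum.cong[OF refl])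
    fix l assume "l \<in> {..N}"
    then have "?v l = ?v N * u l" by (intro vu) simp
    then show "?S n l * ?v l = ?v N * (?S n l * u l)" by (simp only: mult_ac)
  qed
  also have "\<dots> = 0" using u(2)[OF n] by (simp only: sum_distrib_left[symmetric])
  finally show ?thesis by (subst (asm) sum_shifted[OF n]) simp
qed

text \<open>For \<open>n < d\<close> the values form \<nu> applied to the coefficients of
  \<open>rec_det_expansion\<close>, so the inverse of \<nu> returns these coefficients. The scalar
  \<open>b\<close> covers the normalizations of \<open>uvec\<close> and \<open>wvec\<close>
  alike.\<close>

lemma sum_christoffel:
  fixes b x :: real and N :: nat
  defines "\<mu> \<equiv> the (mat_inverse \<nu>) *\<^sub>v Matrix.vec d (\<lambda>n. b * poly (rec_det d C n N) x)"
  shows "(\<Sum>c<d. poly (C c n) x * vec_index \<mu> c) = b * poly (rec_det d C n N) x"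
proof -
  have \<nu>c: "\<nu> \<in> carrier_mat d d" using \<nu> by (simp add: lower_unitriangular_def)
  obtain K where K: "\<And>n. rec_det d C n N = (\<Sum>c<d. C c n * K c)" using rec_det_expansion by blast
  let ?k = "Matrix.vec d (\<lambda>c. b * poly (K c) x)"
  obtain \<nu>' where \<nu>': "mat_inverse \<nu> = Some \<nu>'"
    and inv: "\<nu>' * \<nu> = 1\<^sub>m d" "\<nu>' \<in> carrier_mat d d"
    using mat_inverse_nonsingular[OF \<nu>c] det_\<nu> by auto
  have "Matrix.vec d (\<lambda>n. b * poly (rec_det d C n N) x) = \<nu> *\<^sub>v ?k"
  proof (rule eq_vecI)
    fix n assume "n < dim_vec (\<nu> *\<^sub>v ?k)"
    then have n: "n < d" using \<nu>c by simp
    have "(\<nu> *\<^sub>v ?k) $ n = (\<Sum>c<d. \<nu> $$ (n, c) * (b * poly (K c) x))"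
      using n \<nu>c by (simp add: scalar_prod_def atLeast0LessThan)
    then show "Matrix.vec d (\<lambda>n. b * poly (rec_det d C n N) x) $ n = (\<nu> *\<^sub>v ?k) $ n"
      using n by (simp add: K poly_sum init sum_distrib_left mult.left_commute)
  qed (use \<nu>c in auto)
  then have "\<mu> = \<nu>' *\<^sub>v (\<nu> *\<^sub>v ?k)" by (simp add: \<mu>_def \<nu>')
  also have "\<dots> = ?k" using assoc_mult_mat_vec[OF inv(2) \<nu>c, of ?k] inv(1) by simp
  finally show ?thesis by (simp add: K poly_sum sum_distrib_left mult.left_commute)
qed

end

lemma positive_bandedD:
  assumes "positive_banded p q T"
  shows "n \<le> m + p \<Longrightarrow> m \<le> n + q \<Longrightarrow> 0 < T n m" and "m + p < n \<Longrightarrow> T n m = 0" and "n + q < m \<Longrightarrow> T n m = 0"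
proof -
  have T: "if n \<le> m + p \<and> m \<le> n + q then 0 < T n m else T n m = 0"
    using assms unfolding positive_banded_def by blast
  show "n \<le> m + p \<Longrightarrow> m \<le> n + q \<Longrightarrow> 0 < T n m" "m + p < n \<Longrightarrow> T n m = 0" "n + q < m \<Longrightarrow> T n m = 0"
    using T by (simp_all split: if_splits)
qed

lemma banded_recursion_left:
  assumes "1 \<le> p" and band: "positive_banded p q T" and "lower_unitriangular p \<nu>"
    and rec: "left_recursion_polys p T \<nu> A"
  shows "banded_recursion p T \<nu> A"
proof
  fix c n :: nat and x :: real
  assume c: "c < p"
  have "(\<Sum>l. poly (A c l) x * T l n) = (\<Sum>l\<le>n + p. poly (A c l) x * T l n)"
    by (rule suminf_finite) (simp_all add: positive_bandedD[OF band])
  moreover have "(\<Sum>l. poly (A c l) x * T l n) = x * poly (A c n) x"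
    using rec c unfolding left_recursion_polys_def by blast
  ultimately show "(\<Sum>l\<le>n + p. T l n * poly (A c l) x) = x * poly (A c n) x"
    by (simp only: mult.commute)
next
  show "A c n = [:\<nu> $$ (n, c):]" if "c < p" "n < p" for c n
    using rec that unfolding left_recursion_polys_def by blast
qed (use assms(1,3) positive_bandedD[OF band] in simp_all)

lemma banded_recursion_right:
  assumes "1 \<le> q" and band: "positive_banded p q T" and "lower_unitriangular q \<xi>"
    and rec: "right_recursion_polys q T \<xi> B"
  shows "banded_recursion q (\<lambda>i j. T j i) \<xi> B"
proof
  fix c n :: nat and x :: real
  assume c: "c < q"
  have "(\<Sum>l. T n l * poly (B c l) x) = (\<Sum>l\<le>n + q. T n l * poly (B c l) x)"
    by (rule suminf_finite) (simp_all add: positive_bandedD[OF band])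
  moreover have "(\<Sum>l. T n l * poly (B c l) x) = x * poly (B c n) x"
    using rec c unfolding right_recursion_polys_def by blast
  ultimately show "(\<Sum>l\<le>n + q. T n l * poly (B c l) x) = x * poly (B c n) x" by simp
next
  show "B c n = [:\<xi> $$ (n, c):]" if "c < q" "n < q" for c n
    using rec that unfolding right_recursion_polys_def by blast
qed (use assms(1,3) positive_bandedD[OF band] in simp_all)

section \<open>Spectral decomposition\<close>

lemma biorthogonal_complete:
  fixes U W :: "nat \<Rightarrow> nat \<Rightarrow> real"
  assumes "\<And>k l. k \<le> N \<Longrightarrow> l \<le> N \<Longrightarrow> (\<Sum>i\<le>N. W k i * U l i) = (if k = l then 1 else 0)"
    and "i \<le> N" and "j \<le> N"
  shows "(\<Sum>k\<le>N. U k i * W k j) = (if i = j then 1 else 0)"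
proof -
  let ?W = "leading W (Suc N)" and ?U = "leading (\<lambda>i k. U k i) (Suc N)"
  have "?W * ?U = 1\<^sub>m (Suc N)"
    by (rule eq_matI)
       (auto simp: scalar_prod_def atLeast0LessThan lessThan_Suc_atMost assms(1) simp del: sum.lessThan_Suc)
  then have "?U * ?W = 1\<^sub>m (Suc N)"
    by (rule mat_mult_left_right_inverse[OF leading_carrier leading_carrier])
  then have "(?U * ?W) $$ (i, j) = 1\<^sub>m (Suc N) $$ (i, j)" by simp
  then show ?thesis
    using assms(2,3) by (simp add: scalar_prod_def atLeast0LessThan lessThan_Suc_atMost)
qed

text \<open>Completeness expands the identity, and each further factor acts on the left
  eigenvectors.\<close>

lemma spectral_power:
  fixes U W :: "nat \<Rightarrow> nat \<Rightarrow> real"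
  assumes S: "S \<in> carrier_mat (Suc N) (Suc N)"
    and complete: "\<And>i j. i \<le> N \<Longrightarrow> j \<le> N \<Longrightarrow> (\<Sum>k\<le>N. U k i * W k j) = (if i = j then 1 else 0)"
    and left: "\<And>k j. k \<le> N \<Longrightarrow> j \<le> N \<Longrightarrow> (\<Sum>l\<le>N. W k l * S $$ (l, j)) = c k * W k j"
    and i: "i \<le> N"
  shows "j \<le> N \<Longrightarrow> (S ^\<^sub>m r) $$ (i, j) = (\<Sum>k\<le>N. c k ^ r * (U k i * W k j))"
proof (induction r arbitrary: j)
  case 0
  then show ?case using S i complete by simp
next
  case (Suc r)
  have "(S ^\<^sub>m Suc r) $$ (i, j) = (\<Sum>l\<le>N. (S ^\<^sub>m r) $$ (i, l) * S $$ (l, j))"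
    using S i Suc.prems pow_carrier_mat[OF S, of r]
    by (simp add: scalar_prod_def atLeast0LessThan lessThan_Suc_atMost)
  also have "\<dots> = (\<Sum>l\<le>N. (\<Sum>k\<le>N. c k ^ r * (U k i * W k l)) * S $$ (l, j))"
    by (intro sum.cong refl) (simp add: Suc.IH)
  also have "\<dots> = (\<Sum>k\<le>N. c k ^ r * U k i * (\<Sum>l\<le>N. W k l * S $$ (l, j)))"
    unfolding sum_distrib_left sum_distrib_right
    by (subst sum.swap) (simp add: mult.assoc)
  also have "\<dots> = (\<Sum>k\<le>N. c k ^ Suc r * (U k i * W k j))"
    using Suc.prems by (intro sum.cong refl) (simp add: left)
  finally show ?case .
qed

lemma pow_mat_nonneg:
  assumes S: "S \<in> carrier_mat (Suc N) (Suc N)"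
    and nonneg: "\<And>i j. i \<le> N \<Longrightarrow> j \<le> N \<Longrightarrow> (0::real) \<le> S $$ (i, j)" and i: "i \<le> N"
  shows "j \<le> N \<Longrightarrow> 0 \<le> (S ^\<^sub>m r) $$ (i, j)"
proof (induction r arbitrary: j)
  case 0
  then show ?case using S i by simp
next
  case (Suc r)
  then show ?case
    using S i nonneg pow_carrier_mat[OF S, of r]
    by (auto simp: scalar_prod_def simp del: sum.op_ivl_Suc intro!: sum_nonneg mult_nonneg_nonneg)
qed

lemma dirac_comb_integral_eq:
  assumes "f \<in> borel_measurable borel"
  shows "dirac_comb_integral K c t f = (\<Sum>k\<in>K. complex_of_real (c k) * f (t k))"
  unfolding dirac_comb_integral_def using assms by (intro sum.cong refl) (simp add: integral_return)

lemma mat_inverse_mat_diag: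
  fixes f :: "nat \<Rightarrow> real"
  assumes nz: "\<And>i. i < n \<Longrightarrow> f i \<noteq> 0"
  shows "the (mat_inverse (mat_diag n f)) = mat_diag n (\<lambda>i. 1 / f i)"
proof -
  have c: "mat_diag n f \<in> carrier_mat n n" by simp
  have "Determinant.det (mat_diag n f) = (\<Prod>i = 0..<n. f i)"
    by (subst det_upper_triangular[of _ n]) (auto simp: mat_diag_def prod_list_diag_prod)
  then have "Determinant.det (mat_diag n f) \<noteq> 0" using nz by simp
  then obtain D where D: "mat_inverse (mat_diag n f) = Some D"
    and inv: "D * mat_diag n f = 1\<^sub>m n" "D \<in> carrier_mat n n"
    using mat_inverse_nonsingular[OF c] by auto
  have Df: "D $$ (i, j) * f j = (if i = j then 1 else 0)" if "i < n" "j < n" for i j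
  proof -
    have "(D * mat_diag n f) $$ (i, j) = D $$ (i, j) * f j"
      using that by (simp add: mat_diag_mult_right[OF inv(2)])
    then show ?thesis using that inv(1) by simp
  qed
  then have "D $$ (i, j) = (if i = j then 1 / f j else 0)" if "i < n" "j < n" for i j
  proof (cases "i = j")
    case False
    then show ?thesis using Df[OF that]
        nz[OF that(2)] by simp
  next
    case True
    then show ?thesis using Df[OF that]
        nz[OF that(2)] by (simp add: eq_divide_eq)
  qed
  then have "D = mat_diag n (\<lambda>i. 1 / f i)"
    using inv(2) by (intro eq_matI) (auto simp: mat_diag_def)
  then show ?thesis by (simp add: D)
qed

locale spectral_setting =
  fixes p q :: nat and T :: "nat \<Rightarrow> nat \<Rightarrow> real" and \<nu> \<xi> :: "real mat"
    and A B :: "nat \<Rightarrow> nat \<Rightarrow> real poly" and N :: nat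
  assumes p: "1 \<le> p" and q: "1 \<le> q" and band: "positive_banded p q T"
    and fact: "has_positive_bidiagonal_factorization p q T"
    and \<nu>: "lower_unitriangular p \<nu>" and \<xi>: "lower_unitriangular q \<xi>"
    and A: "left_recursion_polys p T \<nu> A" and B: "right_recursion_polys q T \<xi> B"
begin

abbreviation lam :: "nat \<Rightarrow> real" where "lam \<equiv> eigval T N"
abbreviation u :: "nat \<Rightarrow> nat \<Rightarrow> real" where "u \<equiv> uvec q T B N"
abbreviation w :: "nat \<Rightarrow> nat \<Rightarrow> real" where "w \<equiv> wvec p T A N"
abbreviation That' :: "real mat" where "That' \<equiv> That q T B N"

sublocale left: banded_recursion p T \<nu> A
  by (rule banded_recursion_left[OF p band \<nu> A])

sublocale right: banded_recursion q "\<lambda>i j. T j i" \<xi> B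
  by (rule banded_recursion_right[OF q band \<xi> B])

lemma bidiagonal: "bidiagonal_product T"
  by (rule bidiagonal_product_of_factorization[OF fact p q])

lemma lam_less: "i < j \<Longrightarrow> j \<le> N \<Longrightarrow> lam j < lam i"
  by (rule eigval_charP(1)[OF bidiagonal])

lemma lam_pos: "k \<le> N \<Longrightarrow> lam k > 0"
  by (rule eigval_charP(2)[OF bidiagonal])

lemma charP_lam: "k \<le> N \<Longrightarrow> poly (charP T (Suc N)) (lam k) = 0"
  by (rule eigval_charP(3)[OF bidiagonal])

lemma charP_lam_nonzero: "k \<le> N \<Longrightarrow> poly (charP T N) (lam k) \<noteq> 0"
  by (rule eigval_charP(4)[OF bidiagonal])

lemma pderiv_charP_lam: "k \<le> N \<Longrightarrow> poly (pderiv (charP T (Suc N))) (lam k) \<noteq> 0"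
  by (rule eigval_charP(5)[OF bidiagonal])

text \<open>\<open>beta\<close> is exactly the sign and the superdiagonal product by which
  \<open>rec_det_eq_charP\<close> relates the determinant to \<open>P_N\<close>.\<close>

lemma u_last: "u k N = poly (charP T N) (lam k)"
  using right.rec_det_eq_charP[of N "lam k"]
  by (simp add: uvec_def beta_def charP_transpose[of T] mult_ac)

lemma w_last: "k \<le> N \<Longrightarrow> w k N = 1 / poly (pderiv (charP T (Suc N))) (lam k)"
  using left.rec_det_eq_charP[of N "lam k"] charP_lam_nonzero[of k]
  by (simp add: wvec_def alpha_def mult_ac)

lemma u_right:
  assumes "k \<le> N" and "n \<le> N"
  shows "(\<Sum>l\<le>N. T n l * u k l) = lam k * u k n"
proof -
  have "(\<Sum>l\<le>N. T n l * u k l) =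
      beta q T N * (\<Sum>l\<le>N. T n l * poly (rec_det q B l N) (lam k))"
    by (simp add: uvec_def sum_distrib_left mult.left_commute)
  also have "\<dots> = lam k * u k n"
    using right.rec_det_eigenvector[of N "lam k" n] charP_lam[of k] charP_lam_nonzero[of k] assms
    by (simp add: charP_transpose[of T] uvec_def)
  finally show ?thesis .
qed

lemma w_left:
  assumes "k \<le> N" and "n \<le> N"
  shows "(\<Sum>l\<le>N. w k l * T l n) = lam k * w k n"
proof -
  define c where "c = alpha p T N /
    (poly (charP T N) (lam k) * poly (pderiv (charP T (Suc N))) (lam k))"
  have w: "w k l = c * poly (rec_det p A l N) (lam k)" for l by (simp add: wvec_def c_def)
  have "(\<Sum>l\<le>N. w k l * T l n) = c * (\<Sum>l\<le>N. T l n * poly (rec_det p A l N) (lam k))"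
    by (simp add: w sum_distrib_left mult_ac)
  also have "\<dots> = lam k * w k n"
    using left.rec_det_eigenvector[of N "lam k" n] charP_lam[of k] charP_lam_nonzero[of k] assms
    by (simp add: w)
  finally show ?thesis .
qed

lemma biorthogonal:
  assumes k: "k \<le> N" and l: "l \<le> N"
  shows "(\<Sum>i\<le>N. w k i * u l i) = (if k = l then 1 else 0)"
proof (cases "k = l")
  case True
  \<comment> \<open>By \<open>u_last\<close> and \<open>w_last\<close> the left side is
    \<open>P_N\<close> at the eigenvalue, so the pairing must be 1.\<close>
  have "poly (pderiv (charP T (Suc N))) (lam k) * w k N * u k N =
      poly (charP T N) (lam k) * (\<Sum>i\<le>N. w k i * u k i)"
    by (rule pderiv_charP) (use k u_right w_left charP_lam charP_lam_nonzero in auto)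
  then show ?thesis
    using True k charP_lam_nonzero[OF k] pderiv_charP_lam[OF k] by (simp add: w_last u_last)
next
  case False
  have "lam k * (\<Sum>i\<le>N. w k i * u l i) = (\<Sum>i\<le>N. (\<Sum>j\<le>N. w k j * T j i) * u l i)"
    using k by (simp add: w_left sum_distrib_left mult.assoc)
  also have "\<dots> = (\<Sum>j\<le>N. w k j * (\<Sum>i\<le>N. T j i * u l i))"
    unfolding sum_distrib_left sum_distrib_right by (subst sum.swap) (simp add: mult.assoc)
  also have "\<dots> = lam l * (\<Sum>i\<le>N. w k i * u l i)"
    using l by (simp add: u_right sum_distrib_left mult.left_commute)
  finally have "(lam k - lam l) * (\<Sum>i\<le>N. w k i * u l i) = 0" by (simp add: algebra_simps)
  moreover have "lam k \<noteq> lam l"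
    using lam_less[of k l] lam_less[of l k] False k l by (cases k l rule: linorder_cases) auto
  ultimately show ?thesis using False by simp
qed

lemma complete:
  assumes "i \<le> N" and "j \<le> N"
  shows "(\<Sum>k\<le>N. u k i * w k j) = (if i = j then 1 else 0)"
  by (rule biorthogonal_complete[OF biorthogonal assms])

lemma T_nonneg: "0 \<le> T i j"
  using positive_bandedD[OF band, where n = i and m = j]
  by (cases "i \<le> j + p"; cases "j \<le> i + q") auto

text \<open>The rescaled powers of the nonnegative matrix \<open>T\<^sup>[\<^sup>N\<^sup>]\<close> converge to the rank one matrix
  \<open>u\<^sub>0 w\<^sub>0\<close>, which is therefore nonnegative.\<close>

lemma u_w_nonneg:
  assumes i: "i \<le> N" and j: "j \<le> N"
  shows "0 \<le> u 0 i * w 0 j"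
proof -
  let ?x = "\<lambda>r. \<Sum>k\<le>N. (lam k / lam 0) ^ r * (u k i * w k j)"
  have "(\<lambda>r. (lam k / lam 0) ^ r * (u k i * w k j)) \<longlonglongrightarrow> (if k = 0 then u k i * w k j else 0)"
    if k: "k \<le> N" for k
  proof (cases "k = 0")
    case True
    then show ?thesis using lam_pos[of 0] by simp
  next
    case False
    have "norm (lam k / lam 0) < 1"
      using lam_pos[of 0] lam_pos[of k] lam_less[of 0 k] False k by simp
    then have "(\<lambda>r. (lam k / lam 0) ^ r * (u k i * w k j)) \<longlonglongrightarrow> 0 * (u k i * w k j)"
      by (intro tendsto_mult LIMSEQ_power_zero tendsto_const)
    then show ?thesis using False by simp
  qed
  then have "?x \<longlonglongrightarrow> (\<Sum>k\<le>N. if k = 0 then u k i * w k j else 0)"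
    by (intro tendsto_sum) auto
  then have "?x \<longlonglongrightarrow> u 0 i * w 0 j" by simp
  moreover have "0 \<le> ?x r" for r
  proof -
    have "(trunc T N ^\<^sub>m r) $$ (i, j) = (\<Sum>k\<le>N. lam k ^ r * (u k i * w k j))"
      by (rule spectral_power[OF trunc_carrier complete _ i j]) (simp_all add: w_left)
    moreover have "0 \<le> (trunc T N ^\<^sub>m r) $$ (i, j)"
      by (rule pow_mat_nonneg[OF trunc_carrier _ i j]) (simp add: T_nonneg)
    moreover have "?x r = (\<Sum>k\<le>N. lam k ^ r * (u k i * w k j)) / lam 0 ^ r"
      by (simp add: sum_divide_distrib power_divide)
    ultimately show ?thesis using lam_pos[of 0] by simp
  qed
  ultimately show ?thesis by (intro LIMSEQ_le_const[of ?x]) auto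
qed

text \<open>The last entries are nonzero, which makes the case \<open>i = N\<close> strict. The
  eigenvalue equation then spreads strictness to smaller indices through the positive entries
  \<open>T i (Suc i)\<close>. The factor \<open>w 0 N\<close> stands for the common sign of the
  entries of \<open>u 0\<close>.\<close>

lemma u_sign: 
  assumes "i \<le> N"
  shows "0 < u 0 i * w 0 N"
  using assms
proof (induction rule: inc_induct)
  case base
  have "u 0 N * w 0 N \<noteq> 0"
    using charP_lam_nonzero[of 0] pderiv_charP_lam[of 0] by (simp add: u_last w_last)
  then show ?case using u_w_nonneg[of N N] by linarith
next
  case (step i)
  have "0 < T i (Suc i)" using positive_bandedD(1)[OF band, of i "Suc i"] q by simp
  then have "0 < T i (Suc i) * (u 0 (Suc i) * w 0 N)" using step by simp
  also have "\<dots> \<le> (\<Sum>l\<le>N. T i l * (u 0 l * w 0 N))"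
    using step by (intro member_le_sum mult_nonneg_nonneg T_nonneg u_w_nonneg) auto
  also have "\<dots> = lam 0 * (u 0 i * w 0 N)"
    using u_right[of 0 i] step by (simp add: sum_distrib_right[symmetric] mult.assoc[symmetric])
  finally show ?case using lam_pos[of 0] by (simp add: zero_less_mult_iff)
qed

lemma u_nonzero: "i \<le> N \<Longrightarrow> u 0 i \<noteq> 0"
  using u_sign[of i] by auto

lemma u_ratio_pos:
  assumes "i \<le> N" and "j \<le> N"
  shows "0 < u 0 j / u 0 i"
  using u_sign[OF assms(1)] u_sign[OF assms(2)] by (auto simp: zero_less_mult_iff zero_less_divide_iff)

lemma That_carrier: "That' \<in> carrier_mat (Suc N) (Suc N)"
  using mult_carrier_mat[OF mult_carrier_mat[OF mat_diag_dim trunc_carrier] mat_diag_dim]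
  by (simp add: That_def mat_inverse_mat_diag u_nonzero)

lemma That_index:
  assumes "i \<le> N" and "j \<le> N"
  shows "That' $$ (i, j) = T i j * (u 0 j / u 0 i) / lam 0"
  using assms
  by (simp add: That_def mat_inverse_mat_diag u_nonzero mat_diag_mult_left[OF trunc_carrier]
      mat_diag_mult_right[of _ "Suc N"] less_Suc_eq_le)

lemma That_nonneg: "i \<le> N \<Longrightarrow> j \<le> N \<Longrightarrow> 0 \<le> That' $$ (i, j)"
  using u_ratio_pos[of i j] lam_pos[of 0] T_nonneg[of i j]
  by (simp only: That_index divide_nonneg_pos mult_nonneg_nonneg less_imp_le)

text \<open>Conjugation by the diagonal matrix turns the eigenvectors into
  \<open>u k i / u 0 i\<close> and \<open>w k j * u 0 j\<close>, with eigenvalues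
  \<open>lam k / lam 0\<close>.\<close>

lemma That_power:
  assumes i: "i \<le> N" and j: "j \<le> N"
  shows "(That' ^\<^sub>m r) $$ (i, j) =
    u 0 j / u 0 i * (\<Sum>k\<le>N. (lam k / lam 0) ^ r * (u k i * w k j))"
proof -
  have "(That' ^\<^sub>m r) $$ (i, j) =
      (\<Sum>k\<le>N. (lam k / lam 0) ^ r * ((u k i / u 0 i) * (w k j * u 0 j)))"
  proof (rule spectral_power[OF That_carrier _ _ i j])
    fix i j assume ij: "i \<le> N" "j \<le> N"
    have "(\<Sum>k\<le>N. (u k i / u 0 i) * (w k j * u 0 j)) = (u 0 j / u 0 i) * (\<Sum>k\<le>N. u k i * w k j)"
      by (simp add: sum_distrib_left mult_ac)
    then show "(\<Sum>k\<le>N. (u k i / u 0 i) * (w k j * u 0 j)) = (if i = j then 1 else 0)"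
      using complete[OF ij] u_nonzero[OF ij(1)] by (simp only:) auto
  next
    fix k j assume kj: "k \<le> N" "j \<le> N"
    have "(\<Sum>l\<le>N. w k l * u 0 l * That' $$ (l, j)) = (\<Sum>l\<le>N. (w k l * T l j) * (u 0 j / lam 0))"
      using kj u_nonzero by (intro sum.cong refl) (simp add: That_index)
    also have "\<dots> = lam k / lam 0 * (w k j * u 0 j)"
      using kj by (simp only: sum_distrib_right[symmetric] w_left) simp
    finally show "(\<Sum>l\<le>N. w k l * u 0 l * That' $$ (l, j)) = lam k / lam 0 * (w k j * u 0 j)" .
  qed
  then show ?thesis by (simp add: sum_distrib_left mult_ac)
qed

lemma lam_ratio:
  assumes "k \<le> N"
  shows "norm (complex_of_real (lam k / lam 0)) \<le> 1"
proof -
  have "lam k \<le> lam 0" using lam_less[of 0 k] assms by (cases "k = 0") auto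
  then show ?thesis using lam_pos[OF assms] lam_pos[of 0] by (simp add: norm_divide)
qed

lemma transition_gf_spectral:
  assumes i: "i \<le> N" and j: "j \<le> N" and s: "norm s < 1"
  shows "transition_gf That' i j s = complex_of_real (u 0 j / u 0 i) *
    (\<Sum>k\<le>N. complex_of_real (u k i * w k j) / (1 - s * complex_of_real (lam k / lam 0)))"
proof -
  let ?c = "\<lambda>k. complex_of_real (lam k / lam 0)"
  have "(\<lambda>r. (s * ?c k) ^ r) sums (1 / (1 - s * ?c k))" if "k \<le> N" for k
  proof (rule geometric_sums)
    have "norm (s * ?c k) \<le> norm s * 1"
      unfolding norm_mult by (rule mult_left_mono[OF lam_ratio[OF that]]) simp
    then show "norm (s * ?c k) < 1" using s by simp
  qed
  then have "(\<lambda>r. complex_of_real (u 0 j / u 0 i) *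
      (\<Sum>k\<le>N. complex_of_real (u k i * w k j) * (s * ?c k) ^ r)) sums
    (complex_of_real (u 0 j / u 0 i) * (\<Sum>k\<le>N. complex_of_real (u k i * w k j) * (1 / (1 - s * ?c k))))"
    by (intro sums_mult sums_sum) auto
  moreover have "complex_of_real (u 0 j / u 0 i) * (\<Sum>k\<le>N. complex_of_real (u k i * w k j) * (s * ?c k) ^ r) =
    complex_of_real ((That' ^\<^sub>m r) $$ (i, j)) * s ^ r" for r
  proof -
    have "complex_of_real ((That' ^\<^sub>m r) $$ (i, j)) * s ^ r = complex_of_real (u 0 j / u 0 i) *
        ((\<Sum>k\<le>N. ?c k ^ r * complex_of_real (u k i * w k j)) * s ^ r)"
      unfolding That_power[OF i j] by simp
    also have "(\<Sum>k\<le>N. ?c k ^ r * complex_of_real (u k i * w k j)) * s ^ r =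
        (\<Sum>k\<le>N. complex_of_real (u k i * w k j) * (s * ?c k) ^ r)"
      unfolding sum_distrib_right power_mult_distrib by (simp only: mult_ac)
    finally show ?thesis by (rule sym)
  qed
  ultimately have "(\<lambda>r. complex_of_real ((That' ^\<^sub>m r) $$ (i, j)) * s ^ r) sums
    (complex_of_real (u 0 j / u 0 i) * (\<Sum>k\<le>N. complex_of_real (u k i * w k j) * (1 / (1 - s * ?c k))))"
    by (simp only:)
  then show ?thesis unfolding transition_gf_def by (simp add: sums_iff)
qed

lemma sum_rho: "(\<Sum>b<q. poly (B b m) (lam k) * vec_index (christoffel_rho q T \<xi> B N k) b) = u k m"
  using right.sum_christoffel[where b = "beta q T N" and x = "lam k" and N = N]
  by (simp add: christoffel_rho_def uvec_def[abs_def])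

lemma sum_mu: "(\<Sum>a<p. poly (A a n) (lam k) * vec_index (christoffel_mu p T \<nu> A N k) a) = w k n"
proof -
  let ?c = "alpha p T N / (poly (charP T N) (lam k) * poly (pderiv (charP T (Suc N))) (lam k))"
  have "w k = (\<lambda>n. ?c * poly (rec_det p A n N) (lam k))" by (rule ext) (simp add: wvec_def)
  then show ?thesis
    using left.sum_christoffel[where b = ?c and x = "lam k" and N = N]
    by (simp add: christoffel_mu_def)
qed

lemma spectral_sum_eq:
  "spectral_sum p q T \<nu> \<xi> A B N m n s =
    (\<Sum>k\<le>N. complex_of_real (u k m * w k n) / (1 - s * complex_of_real (lam k / lam 0)))"
proof -
  let ?\<rho> = "\<lambda>k b. complex_of_real (vec_index (christoffel_rho q T \<xi> B N k) b)"
    and ?\<mu> = "\<lambda>k a. complex_of_real (vec_index (christoffel_mu p T \<nu> A N k) a)"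
    and ?g = "\<lambda>x. 1 / (1 - s * complex_of_real (x / lam 0))"
    and ?B = "\<lambda>k b. complex_of_real (poly (B b m) (lam k))"
    and ?A = "\<lambda>k a. complex_of_real (poly (A a n) (lam k))"
  \<comment> \<open>The integrand may have a pole on the real line away from the eigenvalues; with
    division by 0 equal to 0 it is still Borel measurable, as integration against point masses
    requires.\<close>
  have meas: "(\<lambda>x. complex_of_real (poly P x) * ?g x * complex_of_real (poly Q x))
      \<in> borel_measurable borel" for P Q :: "real poly"
  proof -
    have "(\<lambda>x. complex_of_real (poly P x)) \<in> borel_measurable borel" for P :: "real poly"
      by (intro borel_measurable_continuous_onI continuous_intros)
    moreover have "?g \<in> borel_measurable borel"
      by (intro borel_measurable_divide borel_measurable_const borel_measurable_continuous_onI
          continuous_intros) (use lam_pos[of 0] in auto)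
    ultimately show ?thesis by (intro borel_measurable_times)
  qed
  have "spectral_sum p q T \<nu> \<xi> A B N m n s =
    (\<Sum>a<p. \<Sum>b<q. \<Sum>k\<le>N. ?\<rho> k b * ?\<mu> k a * (?B k b * ?g (lam k) * ?A k a))"
    unfolding spectral_sum_def psi_integral_def dirac_comb_integral_eq[OF meas] by simp
  also have "\<dots> = (\<Sum>k\<le>N. \<Sum>a<p. \<Sum>b<q. ?\<rho> k b * ?\<mu> k a * (?B k b * ?g (lam k) * ?A k a))"
    by (simp add: sum.swap[of _ "{..<q}" "{..N}"] sum.swap[of _ "{..<p}" "{..N}"])
  also have "\<dots> = (\<Sum>k\<le>N. (\<Sum>b<q. ?B k b * ?\<rho> k b) * (\<Sum>a<p. ?A k a * ?\<mu> k a) * ?g (lam k))"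
    by (intro sum.cong refl, subst sum.swap)
      (simp only: sum_product sum_distrib_right sum_distrib_left mult_ac)
  also have "\<dots> = (\<Sum>k\<le>N. complex_of_real (u k m * w k n) * ?g (lam k))"
    unfolding sum_rho[symmetric] sum_mu[symmetric] by simp
  finally show ?thesis by simp
qed

end

section \<open>First passages\<close>

text \<open>The weight of the paths from \<open>m\<close> to \<open>j\<close> of length
  \<open>r\<close> that avoid \<open>n\<close> at the times \<open>1, ..., r\<close>. Time 0 is
  exempt, so first returns with \<open>m = n\<close> are covered as well.\<close>

primrec taboo_prob :: "real mat \<Rightarrow> nat \<Rightarrow> nat \<Rightarrow> nat \<Rightarrow> nat \<Rightarrow> nat \<Rightarrow> real" where
  "taboo_prob S N m n 0 j = (if j = m then 1 else 0)"
| "taboo_prob S N m n (Suc r) j =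
     (if j = n then 0 else \<Sum>i\<le>N. taboo_prob S N m n r i * S $$ (i, j))"

text \<open>The index is shifted: \<open>first_entry_prob S N m n r\<close> is the weight of first reaching \<open>n\<close> at time
  \<open>r + 1\<close>.\<close>

definition first_entry_prob :: "real mat \<Rightarrow> nat \<Rightarrow> nat \<Rightarrow> nat \<Rightarrow> nat \<Rightarrow> real" where
  "first_entry_prob S N m n r = (\<Sum>i\<le>N. taboo_prob S N m n r i * S $$ (i, n))"

lemma pow_mat_Suc_index:
  assumes S: "S \<in> carrier_mat (Suc N) (Suc N)" and "i \<le> N" and "j \<le> N"
  shows "(S ^\<^sub>m Suc r) $$ (i, j) = (\<Sum>l\<le>N. (S ^\<^sub>m r) $$ (i, l) * S $$ (l, j))"
  using assms pow_carrier_mat[OF S, of r]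
  by (simp add: scalar_prod_def atLeast0LessThan lessThan_Suc_atMost)

text \<open>Paths are split by the time \<open>k + 1\<close> of their first visit to
  \<open>n\<close>; the taboo term collects those without such a visit.\<close>

lemma pow_mat_first_entry:
  fixes S :: "real mat"
  assumes S: "S \<in> carrier_mat (Suc N) (Suc N)" and m: "m \<le> N" and n: "n \<le> N"
  shows "j \<le> N \<Longrightarrow> (S ^\<^sub>m r) $$ (m, j) =
    taboo_prob S N m n r j + (\<Sum>k<r. first_entry_prob S N m n k * (S ^\<^sub>m (r - Suc k)) $$ (n, j))"
proof (induction r arbitrary: j)
  case 0
  then show ?case using S m by auto
next
  case (Suc r)
  let ?f = "first_entry_prob S N m n" and ?t = "taboo_prob S N m n"
  have "(S ^\<^sub>m Suc r) $$ (m, j) = (\<Sum>i\<le>N. (S ^\<^sub>m r) $$ (m, i) * S $$ (i, j))"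
    by (rule pow_mat_Suc_index[OF S m Suc.prems])
  also have "\<dots> = (\<Sum>i\<le>N. (?t r i + (\<Sum>k<r. ?f k * (S ^\<^sub>m (r - Suc k)) $$ (n, i))) * S $$ (i, j))"
    by (intro sum.cong refl) (simp add: Suc.IH)
  also have "\<dots> = (\<Sum>i\<le>N. ?t r i * S $$ (i, j)) +
      (\<Sum>k<r. ?f k * (\<Sum>i\<le>N. (S ^\<^sub>m (r - Suc k)) $$ (n, i) * S $$ (i, j)))"
    unfolding distrib_right sum.distrib sum_distrib_left sum_distrib_right
    by (subst sum.swap) (simp only: mult.assoc)
  also have "(\<Sum>k<r. ?f k * (\<Sum>i\<le>N. (S ^\<^sub>m (r - Suc k)) $$ (n, i) * S $$ (i, j))) =
      (\<Sum>k<r. ?f k * (S ^\<^sub>m (Suc r - Suc k)) $$ (n, j))"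
  proof (intro sum.cong refl)
    fix k assume "k \<in> {..<r}"
    then have "Suc r - Suc k = Suc (r - Suc k)" by auto
    then show "?f k * (\<Sum>i\<le>N. (S ^\<^sub>m (r - Suc k)) $$ (n, i) * S $$ (i, j)) =
        ?f k * (S ^\<^sub>m (Suc r - Suc k)) $$ (n, j)"
      by (simp only: pow_mat_Suc_index[OF S n Suc.prems])
  qed
  \<comment> \<open>The last step either continues avoiding \<open>n\<close> or enters it for the
    first time. For \<open>j = n\<close> the taboo weight is 0 and the zeroth power contributes 1;
    otherwise it is the other way round.\<close>
  also have "(\<Sum>i\<le>N. ?t r i * S $$ (i, j)) = ?t (Suc r) j + ?f r * (S ^\<^sub>m (Suc r - Suc r)) $$ (n, j)"
    using S n Suc.prems by (simp add: first_entry_prob_def)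
  finally show ?case by simp
qed

lemma taboo_prob_nonneg:
  assumes "\<And>i j. i \<le> N \<Longrightarrow> j \<le> N \<Longrightarrow> 0 \<le> S $$ (i, j)"
  shows "j \<le> N \<Longrightarrow> 0 \<le> taboo_prob S N m n r j"
  by (induction r arbitrary: j) (auto intro!: sum_nonneg mult_nonneg_nonneg assms)

text \<open>The weight is the last summand of the nonnegative decomposition in
  \<open>pow_mat_first_entry\<close>.\<close>

lemma first_entry_prob_bounds:
  assumes S: "S \<in> carrier_mat (Suc N) (Suc N)" and m: "m \<le> N" and n: "n \<le> N"
    and nonneg: "\<And>i j. i \<le> N \<Longrightarrow> j \<le> N \<Longrightarrow> 0 \<le> S $$ (i, j)"
  shows "0 \<le> first_entry_prob S N m n r"
    and "first_entry_prob S N m n r \<le> (S ^\<^sub>m Suc r) $$ (m, n)"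
proof -
  have f: "0 \<le> first_entry_prob S N m n k" for k
    unfolding first_entry_prob_def using n
    by (auto intro!: sum_nonneg mult_nonneg_nonneg nonneg taboo_prob_nonneg)
  then show "0 \<le> first_entry_prob S N m n r" by blast
  have "first_entry_prob S N m n r = first_entry_prob S N m n r * (S ^\<^sub>m (Suc r - Suc r)) $$ (n, n)"
    using S n by simp
  also have "\<dots> \<le> (\<Sum>k<Suc r. first_entry_prob S N m n k * (S ^\<^sub>m (Suc r - Suc k)) $$ (n, n))"
    using n by (intro member_le_sum mult_nonneg_nonneg f pow_mat_nonneg[OF S nonneg]) auto
  also have "\<dots> = (S ^\<^sub>m Suc r) $$ (m, n)"
    using pow_mat_first_entry[OF S m n n, of "Suc r"] by simp
  finally show "first_entry_prob S N m n r \<le> (S ^\<^sub>m Suc r) $$ (m, n)" .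
qed

lemma summable_norm_power_bounded:
  fixes a :: "nat \<Rightarrow> real" and s :: complex
  assumes "\<And>r. \<bar>a r\<bar> \<le> K" and s: "norm s < 1"
  shows "summable (\<lambda>r. norm (complex_of_real (a r) * s ^ r))"
proof (rule summable_comparison_test')
  show "summable (\<lambda>r. K * norm s ^ r)" using s by (intro summable_mult summable_geometric) simp
  show "norm (norm (complex_of_real (a r) * s ^ r)) \<le> K * norm s ^ r" if "r \<ge> 0" for r
    using assms(1)[of r] by (simp add: norm_mult norm_power mult_right_mono)
qed

lemma transition_gf_first_entry:
  fixes s :: complex
  assumes S: "S \<in> carrier_mat (Suc N) (Suc N)" and m: "m \<le> N" and n: "n \<le> N"
    and nonneg: "\<And>i j. i \<le> N \<Longrightarrow> j \<le> N \<Longrightarrow> 0 \<le> S $$ (i, j)"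
    and bound: "\<And>r i j. i \<le> N \<Longrightarrow> j \<le> N \<Longrightarrow> (S ^\<^sub>m r) $$ (i, j) \<le> K" and s: "norm s < 1"
  shows "transition_gf S m n s = (if m = n then 1 else 0) +
    (\<Sum>r. complex_of_real (first_entry_prob S N m n r) * s ^ Suc r) * transition_gf S n n s"
proof -
  let ?f = "first_entry_prob S N m n"
  let ?a = "\<lambda>r. complex_of_real (?f r) * s ^ Suc r"
    and ?b = "\<lambda>r. complex_of_real ((S ^\<^sub>m r) $$ (n, n)) * s ^ r"
  have "\<bar>?f r\<bar> \<le> K" for r
    using first_entry_prob_bounds[OF S m n nonneg, of r] bound[OF m n, of "Suc r"] by simp
  then have "summable (\<lambda>r. norm s * norm (complex_of_real (?f r) * s ^ r))"
    by (intro summable_mult summable_norm_power_bounded s)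
  then have a: "summable (\<lambda>r. norm (?a r))" by (simp add: norm_mult mult_ac)
  have "\<bar>(S ^\<^sub>m r) $$ (n, n)\<bar> \<le> K" for r
    using bound[OF n n, of r] pow_mat_nonneg[OF S nonneg n n, of r] by simp
  then have b: "summable (\<lambda>r. norm (?b r))" by (intro summable_norm_power_bounded s)
  have "(\<lambda>r. \<Sum>k\<le>r. ?a k * ?b (r - k)) sums ((\<Sum>r. ?a r) * (\<Sum>r. ?b r))"
    by (rule Cauchy_product_sums[OF a b])
  moreover have "(\<Sum>k\<le>r. ?a k * ?b (r - k)) = complex_of_real ((S ^\<^sub>m Suc r) $$ (m, n)) * s ^ Suc r" for r
  proof -
    have "(S ^\<^sub>m Suc r) $$ (m, n) = (\<Sum>k\<le>r. ?f k * (S ^\<^sub>m (r - k)) $$ (n, n))"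
      using pow_mat_first_entry[OF S m n n, of "Suc r"] by (simp add: lessThan_Suc_atMost)
    moreover have "?a k * ?b (r - k) =
        complex_of_real (?f k * (S ^\<^sub>m (r - k)) $$ (n, n)) * s ^ Suc r" if "k \<le> r" for k
    proof -
      have "?a k * ?b (r - k) =
          complex_of_real (?f k * (S ^\<^sub>m (r - k)) $$ (n, n)) * (s ^ Suc k * s ^ (r - k))"
        by (simp only: mult_ac of_real_mult)
      also have "s ^ Suc k * s ^ (r - k) = s ^ Suc r" using that by (simp add: power_add[symmetric])
      finally show ?thesis .
    qed
    then have "(\<Sum>k\<le>r. ?a k * ?b (r - k)) =
        (\<Sum>k\<le>r. complex_of_real (?f k * (S ^\<^sub>m (r - k)) $$ (n, n)) * s ^ Suc r)"
      by (intro sum.cong) auto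
    ultimately show ?thesis by (simp only: sum_distrib_right of_real_sum)
  qed
  ultimately have "(\<lambda>r. complex_of_real ((S ^\<^sub>m Suc r) $$ (m, n)) * s ^ Suc r) sums
      ((\<Sum>r. ?a r) * (\<Sum>r. ?b r))" by (simp only:)
  \<comment> \<open>The Cauchy product starts at time 1; the time 0 term supplies the Kronecker
    delta.\<close>
  from sums_Suc[OF this]
  have "(\<lambda>r. complex_of_real ((S ^\<^sub>m r) $$ (m, n)) * s ^ r) sums
      ((\<Sum>r. ?a r) * (\<Sum>r. ?b r) + complex_of_real ((S ^\<^sub>m 0) $$ (m, n)) * s ^ 0)" .
  then have "transition_gf S m n s =
      (\<Sum>r. ?a r) * (\<Sum>r. ?b r) + complex_of_real ((S ^\<^sub>m 0) $$ (m, n)) * s ^ 0"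
    unfolding transition_gf_def by (rule sums_unique[symmetric])
  then show ?thesis using S m n by (simp add: transition_gf_def)
qed

text \<open>The definition of a chain conditions on complete histories. An event \<open>Q\<close>
  that is determined by the times up to \<open>r\<close> and fixes the state at time
  \<open>r\<close> is a finite disjoint union of histories with the same transition
  probability.\<close>

lemma markov_chain_step:
  fixes X :: "nat \<Rightarrow> 'w \<Rightarrow> nat"
  assumes mc: "markov_chain M X N S"
    and dep: "\<And>x y. (\<And>l. l \<le> r \<Longrightarrow> x l = y l) \<Longrightarrow> Q x = Q y"
    and last: "\<And>x. Q x \<Longrightarrow> x r = j" and k: "k \<le> N"
  shows "measure M {\<omega> \<in> space M. Q (\<lambda>l. X l \<omega>) \<and> X (Suc r) \<omega> = k} =
    measure M {\<omega> \<in> space M. Q (\<lambda>l. X l \<omega>)} * S $$ (j, k)"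
proof -
  interpret prob_space M using mc by (simp add: markov_chain_def)
  have X: "X l \<in> measurable M (count_space {..N})" for l using mc by (simp add: markov_chain_def)
  then have [measurable]: "X l \<in> measurable M (count_space UNIV)" for l
    using measurable_compose[of "X l" M "count_space {..N}" "\<lambda>x. x" "count_space UNIV"] by simp
  have XN: "X l \<omega> \<le> N" if "\<omega> \<in> space M" for l \<omega>
    using measurable_space[OF X that] by simp
  \<comment> \<open>Histories are taken undefined beyond \<open>r\<close>, so that there are
    finitely many and different ones give disjoint events.\<close>
  define I where "I = {i \<in> {..r} \<rightarrow>\<^sub>E {..N}. Q i}"
  define E where "E i = {\<omega> \<in> space M. \<forall>l\<le>r. X l \<omega> = i l}" for i
  define F where "F i = {\<omega> \<in> space M. X (Suc r) \<omega> = k \<and> (\<forall>l\<le>r. X l \<omega> = i l)}" for i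
  have I: "finite I" unfolding I_def by (simp add: finite_PiE)
  have E: "E i \<in> sets M" and F: "F i \<in> sets M" for i unfolding E_def F_def by measurable
  have path: "restrict (\<lambda>l. X l \<omega>) {..r} \<in> I" if "\<omega> \<in> space M" "Q (\<lambda>l. X l \<omega>)" for \<omega>
    using that XN dep[of "restrict (\<lambda>l. X l \<omega>) {..r}" "\<lambda>l. X l \<omega>"] by (auto simp: I_def)
  have QE: "Q (\<lambda>l. X l \<omega>)" if "i \<in> I" "\<omega> \<in> E i" for i \<omega>
    using that dep[of i "\<lambda>l. X l \<omega>"] by (auto simp: I_def E_def)
  have eq: "i = i'" if "i \<in> I" "i' \<in> I" "\<omega> \<in> E i" "\<omega> \<in> E i'" for i i' \<omega>
    using that unfolding I_def E_def by (auto intro!: PiE_ext[of i "{..r}" "\<lambda>_. {..N}" i'])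
  have FE: "F i \<subseteq> E i" for i by (auto simp: E_def F_def)
  have "{\<omega> \<in> space M. Q (\<lambda>l. X l \<omega>)} = (\<Union>i\<in>I. E i)"
  proof (intro equalityI subsetI)
    fix \<omega> assume "\<omega> \<in> {\<omega> \<in> space M. Q (\<lambda>l. X l \<omega>)}"
    then show "\<omega> \<in> (\<Union>i\<in>I. E i)" using path[of \<omega>]
      by (intro UN_I[of "restrict (\<lambda>l. X l \<omega>) {..r}"]) (auto simp: E_def)
  next
    fix \<omega> assume "\<omega> \<in> (\<Union>i\<in>I. E i)"
    then show "\<omega> \<in> {\<omega> \<in> space M. Q (\<lambda>l. X l \<omega>)}" using QE by (auto simp: E_def)
  qed
  moreover have "prob (\<Union>i\<in>I. E i) = (\<Sum>i\<in>I. prob (E i))"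
    using E eq by (intro finite_measure_finite_Union I) (auto simp: disjoint_family_on_def)
  ultimately have 1: "prob {\<omega> \<in> space M. Q (\<lambda>l. X l \<omega>)} = (\<Sum>i\<in>I. prob (E i))" by simp
  have "{\<omega> \<in> space M. Q (\<lambda>l. X l \<omega>) \<and> X (Suc r) \<omega> = k} = (\<Union>i\<in>I. F i)"
  proof (intro equalityI subsetI)
    fix \<omega> assume "\<omega> \<in> {\<omega> \<in> space M. Q (\<lambda>l. X l \<omega>) \<and> X (Suc r) \<omega> = k}"
    then show "\<omega> \<in> (\<Union>i\<in>I. F i)" using path[of \<omega>]
      by (intro UN_I[of "restrict (\<lambda>l. X l \<omega>) {..r}"]) (auto simp: F_def)
  next
    fix \<omega> assume "\<omega> \<in> (\<Union>i\<in>I. F i)"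
    then show "\<omega> \<in> {\<omega> \<in> space M. Q (\<lambda>l. X l \<omega>) \<and> X (Suc r) \<omega> = k}"
      using QE FE by (auto simp: F_def)
  qed
  moreover have "prob (\<Union>i\<in>I. F i) = (\<Sum>i\<in>I. prob (F i))"
    using F eq FE by (intro finite_measure_finite_Union I) (fastforce simp: disjoint_family_on_def)+
  ultimately have 2: "prob {\<omega> \<in> space M. Q (\<lambda>l. X l \<omega>) \<and> X (Suc r) \<omega> = k} = (\<Sum>i\<in>I. prob (F i))"
    by simp
  have "prob (F i) = prob (E i) * S $$ (j, k)" if "i \<in> I" for i
  \<comment> \<open>The chain property is silent on null histories, but for them both sides
    vanish.\<close>
  proof (cases "prob (E i) = 0")
    case True
    then show ?thesis using finite_measure_mono[OF FE E, of i] measure_nonneg[of M "F i"] by simp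
  next
    case False
    then have "prob (E i) > 0" using measure_nonneg[of M "E i"] by linarith
    then have "prob (F i) / prob (E i) = S $$ (i r, k)"
      using mc k unfolding markov_chain_def cond_prob_def E_def F_def by blast
    moreover have "i r = j" using that last by (simp add: I_def)
    ultimately show ?thesis using False by (simp add: field_simps)
  qed
  then show ?thesis unfolding 1 2 by (simp add: sum_distrib_right)
qed

lemma markov_chain_total_step:
  fixes X :: "nat \<Rightarrow> 'w \<Rightarrow> nat"
  assumes mc: "markov_chain M X N S"
    and dep: "\<And>x y. (\<And>l. l \<le> r \<Longrightarrow> x l = y l) \<Longrightarrow> Q x = Q y"
    and meas: "\<And>j. {\<omega> \<in> space M. (Q (\<lambda>l. X l \<omega>) \<and> X r \<omega> = j) \<and> X (Suc r) \<omega> = k} \<in> sets M"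
    and k: "k \<le> N"
  shows "measure M {\<omega> \<in> space M. Q (\<lambda>l. X l \<omega>) \<and> X (Suc r) \<omega> = k} =
    (\<Sum>j\<le>N. measure M {\<omega> \<in> space M. Q (\<lambda>l. X l \<omega>) \<and> X r \<omega> = j} * S $$ (j, k))"
proof -
  interpret prob_space M using mc by (simp add: markov_chain_def)
  have X: "X l \<in> measurable M (count_space {..N})" for l using mc by (simp add: markov_chain_def)
  have XN: "X l \<omega> \<le> N" if "\<omega> \<in> space M" for l \<omega>
    using measurable_space[OF X that] by simp
  let ?F = "\<lambda>j. {\<omega> \<in> space M. (Q (\<lambda>l. X l \<omega>) \<and> X r \<omega> = j) \<and> X (Suc r) \<omega> = k}"
  have "{\<omega> \<in> space M. Q (\<lambda>l. X l \<omega>) \<and> X (Suc r) \<omega> = k} = (\<Union>j\<in>{..N}. ?F j)"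
    using XN by auto
  also have "prob \<dots> = (\<Sum>j\<le>N. prob (?F j))"
    using meas by (intro finite_measure_finite_Union) (auto simp: disjoint_family_on_def)
  also have "\<dots> = (\<Sum>j\<le>N. prob {\<omega> \<in> space M. Q (\<lambda>l. X l \<omega>) \<and> X r \<omega> = j} * S $$ (j, k))"
  proof (intro sum.cong refl)
    fix j
    show "prob (?F j) = prob {\<omega> \<in> space M. Q (\<lambda>l. X l \<omega>) \<and> X r \<omega> = j} * S $$ (j, k)"
    proof (rule markov_chain_step[OF mc _ _ k, of r "\<lambda>x. Q x \<and> x r = j" j])
      fix x y :: "nat \<Rightarrow> nat"
      assume "\<And>l. l \<le> r \<Longrightarrow> x l = y l"
      then show "(Q x \<and> x r = j) = (Q y \<and> y r = j)" using dep[of x y] by simp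
    qed simp
  qed
  finally show ?thesis .
qed

lemma first_passage_prob_eq:
  fixes X :: "nat \<Rightarrow> 'w \<Rightarrow> nat"
  assumes mc: "markov_chain M X N S" and n: "n \<le> N"
    and pos: "measure M {\<omega> \<in> space M. X 0 \<omega> = m} > 0"
  shows "first_passage_prob M X m n (Suc r) = first_entry_prob S N m n r"
proof -
  interpret prob_space M using mc by (simp add: markov_chain_def)
  have "X l \<in> measurable M (count_space {..N})" for l using mc by (simp add: markov_chain_def)
  then have [measurable]: "X l \<in> measurable M (count_space UNIV)" for l
    using measurable_compose[of "X l" M "count_space {..N}" "\<lambda>x. x" "count_space UNIV"] by simp
  let ?c = "prob {\<omega> \<in> space M. X 0 \<omega> = m}"
  \<comment> \<open>The event behind \<open>taboo_prob\<close>. Its probability carries the factor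
    \<open>?c\<close> of the starting state, which the conditioning divides out; hence the
    hypothesis \<open>pos\<close>.\<close>
  define Q where "Q r x \<longleftrightarrow> x 0 = m \<and> (\<forall>l\<in>{1..r}. x l \<noteq> n)" for r and x :: "nat \<Rightarrow> nat"
  have Q: "Q r x = Q r y" if "\<And>l. l \<le> r \<Longrightarrow> x l = y l" for r x y
    using that by (auto simp: Q_def)
  have meas: "{\<omega> \<in> space M. (Q r (\<lambda>l. X l \<omega>) \<and> X r \<omega> = j) \<and> X (Suc r) \<omega> = k} \<in> sets M" for r j k
    unfolding Q_def by measurable
  have G: "prob {\<omega> \<in> space M. Q r (\<lambda>l. X l \<omega>) \<and> X r \<omega> = j} = ?c * taboo_prob S N m n r j"
    if "j \<le> N" for j
    using that
  proof (induction r arbitrary: j)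
    case 0
    have "{\<omega> \<in> space M. Q 0 (\<lambda>l. X l \<omega>) \<and> X 0 \<omega> = j} =
        (if j = m then {\<omega> \<in> space M. X 0 \<omega> = m} else {})"
      by (auto simp: Q_def)
    then show ?case by simp
  next
    case (Suc r)
    have "{\<omega> \<in> space M. Q (Suc r) (\<lambda>l. X l \<omega>) \<and> X (Suc r) \<omega> = j} =
        (if j = n then {} else {\<omega> \<in> space M. Q r (\<lambda>l. X l \<omega>) \<and> X (Suc r) \<omega> = j})"
      by (auto simp: Q_def atLeastAtMostSuc_conv)
    moreover have "prob {\<omega> \<in> space M. Q r (\<lambda>l. X l \<omega>) \<and> X (Suc r) \<omega> = j} =
        ?c * (\<Sum>i\<le>N. taboo_prob S N m n r i * S $$ (i, j))"
    proof -
      have "prob {\<omega> \<in> space M. Q r (\<lambda>l. X l \<omega>) \<and> X (Suc r) \<omega> = j} =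
          (\<Sum>i\<le>N. prob {\<omega> \<in> space M. Q r (\<lambda>l. X l \<omega>) \<and> X r \<omega> = i} * S $$ (i, j))"
        by (rule markov_chain_total_step[OF mc Q meas Suc.prems])
      also have "\<dots> = ?c * (\<Sum>i\<le>N. taboo_prob S N m n r i * S $$ (i, j))"
        unfolding sum_distrib_left by (intro sum.cong refl) (simp add: Suc.IH)
      finally show ?thesis .
    qed
    ultimately show ?case by simp
  qed
  have "prob {\<omega> \<in> space M. Q r (\<lambda>l. X l \<omega>) \<and> X (Suc r) \<omega> = n} =
      (\<Sum>i\<le>N. prob {\<omega> \<in> space M. Q r (\<lambda>l. X l \<omega>) \<and> X r \<omega> = i} * S $$ (i, n))"
    by (rule markov_chain_total_step[OF mc Q meas n])
  also have "\<dots> = ?c * first_entry_prob S N m n r"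
    unfolding first_entry_prob_def sum_distrib_left by (intro sum.cong refl) (simp add: G)
  finally have "prob {\<omega> \<in> space M. Q r (\<lambda>l. X l \<omega>) \<and> X (Suc r) \<omega> = n} = ?c * first_entry_prob S N m n r" .
  moreover have "{\<omega> \<in> space M. (X (Suc r) \<omega> = n \<and> (\<forall>l. 1 \<le> l \<and> l < Suc r \<longrightarrow> X l \<omega> \<noteq> n)) \<and> X 0 \<omega> = m} =
      {\<omega> \<in> space M. Q r (\<lambda>l. X l \<omega>) \<and> X (Suc r) \<omega> = n}"
    by (auto simp: Q_def)
  ultimately show ?thesis
    using pos by (simp add: first_passage_prob_def cond_prob_def)
qed

section \<open>Generating functions of the chain\<close>

context spectral_setting
begin

text \<open>The ratios \<open>lam k / lam 0\<close> lie between 0 and 1. Summing over all pairs of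
  states makes the bound uniform in \<open>i\<close>, \<open>j\<close> and \<open>r\<close>, as
  \<open>transition_gf_first_entry\<close> requires.\<close>

lemma That_power_bound:
  assumes i: "i \<le> N" and j: "j \<le> N"
  shows "(That' ^\<^sub>m r) $$ (i, j) \<le> (\<Sum>m\<le>N. \<Sum>n\<le>N. u 0 n / u 0 m * (\<Sum>k\<le>N. \<bar>u k m * w k n\<bar>))"
proof -
  let ?h = "\<lambda>m n. u 0 n / u 0 m * (\<Sum>k\<le>N. \<bar>u k m * w k n\<bar>)"
  have h: "0 \<le> ?h m n" if "m \<le> N" "n \<le> N" for m n
    using u_ratio_pos[OF that] by (intro mult_nonneg_nonneg sum_nonneg) auto
  have "(\<Sum>k\<le>N. (lam k / lam 0) ^ r * (u k i * w k j)) \<le> (\<Sum>k\<le>N. \<bar>u k i * w k j\<bar>)"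
  proof (rule sum_mono)
    fix k assume "k \<in> {..N}"
    then have k: "k \<le> N" by simp
    have "lam k \<le> lam 0" using lam_less[of 0 k] k by (cases "k = 0") auto
    then have "0 \<le> lam k / lam 0" "lam k / lam 0 \<le> 1" using lam_pos[OF k] lam_pos[of 0] by auto
    then have "0 \<le> (lam k / lam 0) ^ r" "(lam k / lam 0) ^ r \<le> 1"
      by (simp_all only: zero_le_power power_le_one)
    then have "(lam k / lam 0) ^ r * \<bar>u k i * w k j\<bar> \<le> 1 * \<bar>u k i * w k j\<bar>"
      by (intro mult_right_mono) auto
    moreover have "(lam k / lam 0) ^ r * (u k i * w k j) \<le> (lam k / lam 0) ^ r * \<bar>u k i * w k j\<bar>"
      using \<open>0 \<le> (lam k / lam 0) ^ r\<close> by (intro mult_left_mono) auto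
    ultimately show "(lam k / lam 0) ^ r * (u k i * w k j) \<le> \<bar>u k i * w k j\<bar>" by linarith
  qed
  then have "(That' ^\<^sub>m r) $$ (i, j) \<le> ?h i j"
    unfolding That_power[OF i j] using u_ratio_pos[OF i j] by (intro mult_left_mono) auto
  also have "\<dots> \<le> (\<Sum>n\<le>N. ?h i n)" using i j h by (intro member_le_sum) auto
  also have "\<dots> \<le> (\<Sum>m\<le>N. \<Sum>n\<le>N. ?h m n)"
    using i h by (intro member_le_sum[of i "{..N}" "\<lambda>m. \<Sum>n\<le>N. ?h m n"] sum_nonneg) auto
  finally show ?thesis .
qed

lemma transition_gf_eq:
  assumes "m \<le> N" and "n \<le> N" and "norm s < 1"
  shows "transition_gf That' m n s =
    complex_of_real (u 0 n / u 0 m) * spectral_sum p q T \<nu> \<xi> A B N m n s"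
  using transition_gf_spectral[OF assms] by (simp only: spectral_sum_eq)

lemma transition_gf_first_passage:
  assumes mc: "markov_chain M X N That'" and m: "m \<le> N" and n: "n \<le> N"
    and pos: "measure M {\<omega> \<in> space M. X 0 \<omega> = m} > 0" and s: "norm s < 1"
  shows "transition_gf That' m n s =
    (if m = n then 1 else 0) + first_passage_gf M X m n s * transition_gf That' n n s"
  using transition_gf_first_entry[OF That_carrier m n That_nonneg That_power_bound s]
  unfolding first_passage_gf_def first_passage_prob_eq[OF mc n pos] .

text \<open>If the value were 0, the renewal equation for \<open>m = n\<close> would read
  \<open>0 = 1\<close>. The matrix version is used, so the initial distribution may give
  \<open>n\<close> probability 0.\<close>

lemma transition_gf_diag_nonzero:
  assumes n: "n \<le> N" and s: "norm s < 1"
  shows "transition_gf That' n n s \<noteq> 0"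
  using transition_gf_first_entry[OF That_carrier n n That_nonneg That_power_bound s] by auto

lemma spectral_sum_diag:
  assumes n: "n \<le> N" and s: "norm s < 1"
  shows "spectral_sum p q T \<nu> \<xi> A B N n n s = transition_gf That' n n s"
  using transition_gf_eq[OF n n s] u_nonzero[OF n] by simp

end

theorem proposition2p10:
  fixes p q N :: nat
    and T :: "nat \<Rightarrow> nat \<Rightarrow> real"
    and \<nu> \<xi> :: "real mat"
    and A B :: "nat \<Rightarrow> nat \<Rightarrow> real poly"
    and M :: "'w measure"
    and X :: "nat \<Rightarrow> 'w \<Rightarrow> nat"
    and s :: complex
  assumes "1 \<le> p" and "1 \<le> q"
    and "stochastic_smat T"
    and "positive_banded p q T"
    and "has_positive_bidiagonal_factorization p q T"
    and "lower_unitriangular p \<nu>"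
    and "lower_unitriangular q \<xi>"
    and "left_recursion_polys p T \<nu> A"
    and "right_recursion_polys q T \<xi> B"
    and "markov_chain M X N (That q T B N)"
    and "norm s < 1"
  shows
    "(\<forall>n\<le>N. \<forall>m\<le>N.
        transition_gf (That q T B N) m n s =
          complex_of_real (uvec q T B N 0 n / uvec q T B N 0 m) *
          spectral_sum p q T \<nu> \<xi> A B N m n s) \<and>
     (\<forall>n\<le>N. \<forall>m\<le>N. m \<noteq> n \<longrightarrow> \<P>(\<omega> in M. X 0 \<omega> = m) > 0 \<longrightarrow>
        first_passage_gf M X m n s =
          complex_of_real (uvec q T B N 0 n / uvec q T B N 0 m) *
          (spectral_sum p q T \<nu> \<xi> A B N m n s / spectral_sum p q T \<nu> \<xi> A B N n n s)) \<and>
     (\<forall>m\<le>N. \<P>(\<omega> in M. X 0 \<omega> = m) > 0 \<longrightarrow>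
        first_passage_gf M X m m s = 1 - 1 / spectral_sum p q T \<nu> \<xi> A B N m m s)"
proof -
  interpret spectral_setting p q T \<nu> \<xi> A B N
    using assms by unfold_locales
  note mc = \<open>markov_chain M X N (That q T B N)\<close> and s = \<open>norm s < 1\<close>
  show ?thesis
  proof (intro conjI allI impI)
    fix n m
    assume n: "n \<le> N" and m: "m \<le> N"
    show "transition_gf (That q T B N) m n s = complex_of_real (uvec q T B N 0 n / uvec q T B N 0 m) *
        spectral_sum p q T \<nu> \<xi> A B N m n s"
      by (rule transition_gf_eq[OF m n s])
    assume "m \<noteq> n" and pos: "\<P>(\<omega> in M. X 0 \<omega> = m) > 0"
    then have "transition_gf (That q T B N) m n s =
        first_passage_gf M X m n s * transition_gf (That q T B N) n n s"
      using transition_gf_first_passage[OF mc m n _ s] by simp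
    then have "first_passage_gf M X m n s =
        transition_gf (That q T B N) m n s / spectral_sum p q T \<nu> \<xi> A B N n n s"
      using transition_gf_diag_nonzero[OF n s] by (simp add: spectral_sum_diag[OF n s])
    then show "first_passage_gf M X m n s =
        complex_of_real (uvec q T B N 0 n / uvec q T B N 0 m) *
        (spectral_sum p q T \<nu> \<xi> A B N m n s / spectral_sum p q T \<nu> \<xi> A B N n n s)"
      unfolding transition_gf_eq[OF m n s] by simp
  next
    fix m
    assume m: "m \<le> N" and pos: "\<P>(\<omega> in M. X 0 \<omega> = m) > 0"
    have "transition_gf (That q T B N) m m s =
        1 + first_passage_gf M X m m s * transition_gf (That q T B N) m m s"
      using transition_gf_first_passage[OF mc m m _ s] pos by simp
    then show "first_passage_gf M X m m s = 1 - 1 / spectral_sum p q T \<nu> \<xi> A B N m m s"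
      unfolding spectral_sum_diag[OF m s] using transition_gf_diag_nonzero[OF m s]
      by (simp add: field_simps)
  qed
qed

end
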